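(* Let $\mathbb{K}$ be a field of characteristic zero, let $A\in\mathbb{K}^{n\times n}$, and suppose that the irreducible factorization $\chi_A(\lambda)=f_1(\lambda)^{m_1}\cdots f_q(\lambda)^{m_q}$ of its characteristic polynomial is given. When the vectors $\bm{u}g_1(A),\ldots,\bm{u}g_q(A)$ needed in Algorithm P are calculated by binary splitting, Algorithm M (both algorithms are described in the context) calculates the unit minimal annihilating polynomials $\pi_{A,1}(\lambda),\ldots,\pi_{A,n}(\lambda)$ (i.e. their exponents $r_{i,j}$) with $$O\biggl( n^3\max\{1,\log_2 q\}+n^2\deg(\pi_A(\lambda))+n^2\sum_{j=1}^n\deg\pi'_{A,j}(\lambda)+n^2\sum_{j=1}^{n}\sum_{k=1}^{q''_j}d_k\{(m_k-\rho_{k,j})+k\delta_{k,j}\} \biggr)$$ arithmetic operations in $\mathbb{K}$.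
   Context: Setting. $f_1,\ldots,f_q$ are the pairwise distinct monic irreducible factors of $\chi_A$ over $\mathbb{K}$, $m_p\ge1$, $d_p=\deg f_p$, $F_p=f_p(A)$, $g_p(\lambda)=\chi_A(\lambda)/f_p(\lambda)^{m_p}$. $\pi_A$ is the minimal polynomial of $A$. The $j$-th unit minimal annihilating polynomial $\pi_{A,j}$ is the monic generator of the ideal $\{p\in\mathbb{K}[\lambda]\mid p(A)\bm{e}_j=\bm{0}\}$, with $\bm{e}_j$ the $j$-th unit column vector; write $\pi_{A,j}=\prod_{i=1}^q f_i^{r_{i,j}}$ with $0\le r_{i,j}\le m_i$. Cost model. Time is counted in arithmetic operations in $\mathbb{K}$; the factorization of $\chi_A$ is assumed given. A product $f(A)\bm{v}$ (or $\bm{w}f(A)$) with $\deg f=d$ is computed by Horner's rule with matrix-vector products, at cost $O(n^2d)$. Algorithm P (unit pseudo annihilating polynomials). Generate a random (nonzero) row vector $\bm{u}\in\mathbb{K}^n$. For $i=1,\ldots,q$: compute $\bar{\bm{b}}=\bm{u}g_i(A)$; then for $k=0,1,\ldots,m_i-1$, for every $j$ whose exponent $\rho_{i,j}$ has not yet been set and for which the $j$-th entry of $\bar{\bm{b}}$ is $0$, set $\rho_{i,j}=k$, and then replace $\bar{\bm{b}}$ by $\bar{\bm{b}}f_i(A)$ (this loop is left as soon as, at the start of a pass, $\bar{\bm{b}}=\bm{0}$ and all $\rho_{i,j}$, $1\le j\le n$, are set); finally set every still unset $\rho_{i,j}$ to $m_i$. Output $(\rho_{i,j})$. The polynomial $\pi'_{A,j}=\prod_{i=1}^q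 f_i^{\rho_{i,j}}$ is called a $j$-th unit pseudo annihilating polynomial; it divides $\pi_{A,j}$. Binary splitting. The binary tree has nodes of the form $S(p',p'')=\{p',p'+1,\ldots,p''\}$, with root $S=S(1,q)=\{1,\ldots,q\}$; a node $S(p',p'')$ with $p'<p''$ has children $S(p',p'+\lfloor(p''-p')/2\rfloor)$ and $S(p'+\lfloor(p''-p')/2\rfloor+1,p'')$; a node with $p'=p''$ is a leaf. For a node $I$ put $\bm{v}_I=\bm{u}\prod_{j\in S\setminus I}F_j^{m_j}$. Starting from $\bm{v}_S=\bm{u}$, for each child $J$ of $I$ one computes $\bm{v}_J=\bm{v}_I\prod_{j\in I\setminus J}F_j^{m_j}$; the leaves give $\bm{v}_{\{p\}}=\bm{u}g_p(A)$. Algorithm M (unit minimal annihilating polynomials). Compute $(\rho_{i,j})$ by Algorithm P and set $r_{i,j}\leftarrow\rho_{i,j}$ for all $i,j$. For each $j=1,\ldots,n$: (1) Compute $\bm{v}\leftarrow\pi'_{A,j}(A)\bm{e}_j$. If $\bm{v}=\bm{0}$, go to the next $j$. Otherwise set $\bm{v}_0\leftarrow\bm{v}$. (2) For $i=1,2,\ldots,q$: for $l=1,\ldots,m_i-\rho_{i,j}$ replace $\bm{v}\leftarrow f_i(A)\bm{v}$, and if now $\bm{v}=\bm{0}$, set $r_{i,j}\leftarrow\rho_{i,j}+l$ and $\bm{v}_i\leftarrow\bm{0}$, replace $\bm{v}_k\leftarrow f_i(A)^l\bm{v}_k$ for $k=i-1,\ldots,0$, and leave the loops over both $l$ and $i$,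 keeping the current value of $i$. If $\bm{v}\neq\bm{0}$ after the loop over $l$, set $\bm{v}_i\leftarrow\bm{v}$ and continue with the next $i$. (3) With $i$ the value at which step (2) stopped, for $k=i-1,\ldots,1$: set $\bm{v}\leftarrow\bm{v}_{k-1}$; for $l=0,1,\ldots,m_k-\rho_{k,j}-1$: if $\bm{v}=\bm{0}$, replace $\bm{v}_s\leftarrow f_k(A)^l\bm{v}_s$ for $s=k-2,\ldots,0$ and leave the loop over $l$; otherwise replace $\bm{v}\leftarrow f_k(A)\bm{v}$ and $r_{k,j}\leftarrow r_{k,j}+1$. Output $(r_{i,j})$. Quantities in the bound. $\rho_{i,j}$ and $\pi'_{A,j}$ are those produced by Algorithm P; $\delta_{i,j}=r_{i,j}-\rho_{i,j}$ (with $r_{i,j}$ the exponents in $\pi_{A,j}$), and $q''_j=\max\{1\le i\le q\mid\rho_{i,j}<r_{i,j}\}$, the inner sum being empty if no such $i$ exists.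
   Formalization: In step (3) of Algorithm M the loop over l runs to m_k−ρ_{k,j}, not m_k−ρ_{k,j}−1: without this extra pass the vectors v_{k-2},…,v_0 can miss the factor f_k(A)^{m_k−ρ_{k,j}}, and the computed exponents r_{i,j} can come out too large. *)

theory Defs
  imports "Jordan_Normal_Form.Char_Poly" "HOL-Library.Monad_Syntax"
begin

section \<open>Annihilating polynomials\<close>

definition poly_mat :: "'a::comm_ring_1 poly \<Rightarrow> 'a mat \<Rightarrow> 'a mat" where
  "poly_mat p A = mat (dim_row A) (dim_row A)
     (\<lambda>(i, j). \<Sum>k\<le>degree p. coeff p k * (A ^\<^sub>m k) $$ (i, j))"

definition monic_generator :: "'a::field poly set \<Rightarrow> 'a poly" where
  "monic_generator I = (THE p. lead_coeff p = 1 \<and> I = {g. p dvd g})"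

definition min_poly :: "'a::field mat \<Rightarrow> 'a poly" where
  "min_poly A = monic_generator {p. poly_mat p A = 0\<^sub>m (dim_row A) (dim_row A)}"

text \<open>Vector entries and the index \<open>j\<close> of \<open>e\<^sub>j\<close> are counted from \<open>0\<close>, following
  \<^const>\<open>unit_vec\<close>; the indices \<open>i\<close> of the irreducible factors are counted from \<open>1\<close>.\<close>

definition unit_min_poly :: "'a::field mat \<Rightarrow> nat \<Rightarrow> 'a poly" where
  "unit_min_poly A j = monic_generator
     {p. poly_mat p A *\<^sub>v unit_vec (dim_row A) j = 0\<^sub>v (dim_row A)}"


section \<open>Counting arithmetic operations\<close>

text \<open>The second component is the number of additions and multiplications of field elements.
  Comparisons with zero, index computations and data movement are free.\<close>

type_synonym 'b counted = "'b \<times> nat"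

definition ret :: "'b \<Rightarrow> 'b counted" where
  "ret x = (x, 0)"

definition counted_bind :: "'b counted \<Rightarrow> ('b \<Rightarrow> 'c counted) \<Rightarrow> 'c counted" where
  "counted_bind x f = (fst (f (fst x)), snd x + snd (f (fst x)))"

adhoc_overloading Monad_Syntax.bind \<rightleftharpoons> counted_bind

abbreviation result :: "'b counted \<Rightarrow> 'b" where
  "result \<equiv> fst"

abbreviation ops :: "'b counted \<Rightarrow> nat" where
  "ops \<equiv> snd"

definition add_op :: "'a::field \<Rightarrow> 'a \<Rightarrow> 'a counted" where
  "add_op x y = (x + y, 1)"

definition mult_op :: "'a::field \<Rightarrow> 'a \<Rightarrow> 'a counted" where
  "mult_op x y = (x * y, 1)"

primrec map_counted :: "('b \<Rightarrow> 'c counted) \<Rightarrow> 'b list \<Rightarrow> 'c list counted" where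
  "map_counted f [] = ret []"
| "map_counted f (x # xs) =
     do { y \<leftarrow> f x; ys \<leftarrow> map_counted f xs; ret (y # ys) }"

primrec fold_counted :: "('b \<Rightarrow> 'c \<Rightarrow> 'c counted) \<Rightarrow> 'b list \<Rightarrow> 'c \<Rightarrow> 'c counted" where
  "fold_counted f [] s = ret s"
| "fold_counted f (x # xs) s = do { s' \<leftarrow> f x s; fold_counted f xs s' }"

definition vec_counted :: "nat \<Rightarrow> (nat \<Rightarrow> 'a counted) \<Rightarrow> 'a vec counted" where
  "vec_counted n f = do { xs \<leftarrow> map_counted f [0..<n]; ret (vec_of_list xs) }"

definition add_vec_op :: "'a::field vec \<Rightarrow> 'a vec \<Rightarrow> 'a vec counted" where
  "add_vec_op v w = vec_counted (dim_vec v) (\<lambda>i. add_op (v $ i) (w $ i))"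

definition smult_vec_op :: "'a::field \<Rightarrow> 'a vec \<Rightarrow> 'a vec counted" where
  "smult_vec_op c v = vec_counted (dim_vec v) (\<lambda>i. mult_op c (v $ i))"

definition scalar_prod_op :: "'a::field vec \<Rightarrow> 'a vec \<Rightarrow> 'a counted" where
  "scalar_prod_op v w =
     fold_counted (\<lambda>k s. do { t \<leftarrow> mult_op (v $ k) (w $ k); add_op s t }) [0..<dim_vec w] 0"

definition mat_vec_op :: "'a::field mat \<Rightarrow> 'a vec \<Rightarrow> 'a vec counted" where
  "mat_vec_op A v = vec_counted (dim_row A) (\<lambda>i. scalar_prod_op (row A i) v)"

definition vec_mat_op :: "'a::field mat \<Rightarrow> 'a vec \<Rightarrow> 'a vec counted" where
  "vec_mat_op A w = vec_counted (dim_col A) (\<lambda>j. scalar_prod_op w (col A j))"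

text \<open>In the following, \<open>mul\<close> is either \<open>mat_vec_op A\<close> or \<open>vec_mat_op A\<close>, so that
  \<open>horner_op mul p v\<close> is \<open>p(A) v\<close> or \<open>v p(A)\<close>.\<close>

fun horner_coeffs ::
  "('a::field vec \<Rightarrow> 'a vec counted) \<Rightarrow> 'a list \<Rightarrow> 'a vec \<Rightarrow> 'a vec counted" where
  "horner_coeffs mul [] v = ret (0\<^sub>v (dim_vec v))"
| "horner_coeffs mul [c] v = smult_vec_op c v"
| "horner_coeffs mul (c # c' # cs) v =
     do { b \<leftarrow> horner_coeffs mul (c' # cs) v;
          b' \<leftarrow> mul b;
          w \<leftarrow> smult_vec_op c v;
          add_vec_op b' w }"

definition horner_op ::
  "('a::field vec \<Rightarrow> 'a vec counted) \<Rightarrow> 'a poly \<Rightarrow> 'a vec \<Rightarrow> 'a vec counted" where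
  "horner_op mul p v = horner_coeffs mul (coeffs p) v"

primrec apply_power ::
  "('a::field vec \<Rightarrow> 'a vec counted) \<Rightarrow> 'a poly \<Rightarrow> nat \<Rightarrow> 'a vec \<Rightarrow> 'a vec counted" where
  "apply_power mul p 0 v = ret v"
| "apply_power mul p (Suc l) v = do { w \<leftarrow> horner_op mul p v; apply_power mul p l w }"

definition apply_factors ::
  "('a::field vec \<Rightarrow> 'a vec counted) \<Rightarrow> (nat \<Rightarrow> 'a poly) \<Rightarrow> (nat \<Rightarrow> nat) \<Rightarrow> nat list
     \<Rightarrow> 'a vec \<Rightarrow> 'a vec counted" where
  "apply_factors mul f e is v = fold_counted (\<lambda>i w. apply_power mul (f i) (e i) w) is v"


section \<open>Unit pseudo annihilating polynomials\<close>

text \<open>The subtree below the node \<open>{a..b}\<close> whose vector is \<open>v\<close>; the result lists the vectors at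
  its leaves from left to right.\<close>

function split_vecs ::
  "'a::field mat \<Rightarrow> (nat \<Rightarrow> 'a poly) \<Rightarrow> (nat \<Rightarrow> nat) \<Rightarrow> nat \<Rightarrow> nat \<Rightarrow> 'a vec
     \<Rightarrow> 'a vec list counted" where
  "split_vecs A f m a b v =
     (if b \<le> a then ret [v]
      else let h = a + (b - a) div 2 in
        do { vl \<leftarrow> apply_factors (vec_mat_op A) f m [Suc h..<Suc b] v;
             vr \<leftarrow> apply_factors (vec_mat_op A) f m [a..<Suc h] v;
             ls \<leftarrow> split_vecs A f m a h vl;
             rs \<leftarrow> split_vecs A f m (Suc h) b vr;
             ret (ls @ rs) })"
  by pat_completeness auto
termination
  by (relation "measure (\<lambda>(A, f, m, a, b, v). b - a)") auto

text \<open>\<open>pseudo_loop A p t k b s\<close> performs the passes \<open>k, \<dots>, k + t - 1\<close>; \<open>s j = None\<close> means that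
  the exponent for \<open>j\<close> has not been set.\<close>

primrec pseudo_loop ::
  "'a::field mat \<Rightarrow> 'a poly \<Rightarrow> nat \<Rightarrow> nat \<Rightarrow> 'a vec \<Rightarrow> (nat \<Rightarrow> nat option)
     \<Rightarrow> (nat \<Rightarrow> nat option) counted" where
  "pseudo_loop A p 0 k b s = ret s"
| "pseudo_loop A p (Suc t) k b s =
     (if b = 0\<^sub>v (dim_row A) \<and> (\<forall>j<dim_row A. s j \<noteq> None) then ret s
      else
        let s' = (\<lambda>j. if j < dim_row A \<and> s j = None \<and> b $ j = 0 then Some k else s j) in
        do { b' \<leftarrow> horner_op (vec_mat_op A) p b; pseudo_loop A p t (Suc k) b' s' })"

definition pseudo_row ::
  "'a::field mat \<Rightarrow> 'a poly \<Rightarrow> nat \<Rightarrow> 'a vec \<Rightarrow> (nat \<Rightarrow> nat) counted" where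
  "pseudo_row A p mp b =
     do { s \<leftarrow> pseudo_loop A p mp 0 b (\<lambda>_. None);
          ret (\<lambda>j. case s j of None \<Rightarrow> mp | Some k \<Rightarrow> k) }"

text \<open>The result maps \<open>i\<close> and \<open>j\<close> to \<open>\<rho>\<^sub>i\<^sub>j\<close>.\<close>

definition alg_pseudo ::
  "'a::field mat \<Rightarrow> nat \<Rightarrow> (nat \<Rightarrow> 'a poly) \<Rightarrow> (nat \<Rightarrow> nat) \<Rightarrow> 'a vec
     \<Rightarrow> (nat \<Rightarrow> nat \<Rightarrow> nat) counted" where
  "alg_pseudo A q f m u =
     do { bs \<leftarrow> split_vecs A f m 1 q u;
          rs \<leftarrow> map_counted (\<lambda>i. pseudo_row A (f i) (m i) (bs ! (i - 1))) [1..<Suc q];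
          ret (\<lambda>i j. (rs ! (i - 1)) j) }"


section \<open>Unit minimal annihilating polynomials\<close>

text \<open>In this section \<open>j\<close> is fixed, \<open>\<rho> i\<close> and \<open>r i\<close> stand for \<open>\<rho>\<^sub>i\<^sub>j\<close> and \<open>r\<^sub>i\<^sub>j\<close>, and
  \<open>vs i\<close> holds the vector \<open>v\<^sub>i\<close>.\<close>

definition update_vecs ::
  "'a::field mat \<Rightarrow> 'a poly \<Rightarrow> nat \<Rightarrow> nat list \<Rightarrow> (nat \<Rightarrow> 'a vec) \<Rightarrow> (nat \<Rightarrow> 'a vec) counted" where
  "update_vecs A p l ks vs =
     fold_counted (\<lambda>k ws. do { w \<leftarrow> apply_power (mat_vec_op A) p l (ws k); ret (ws(k := w)) }) ks vs"

text \<open>Multiplies by \<open>p(A)\<close> along a list of counters \<open>l\<close>: the first component is the \<open>l\<close> at which the vector became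
  zero, if it did.\<close>

primrec ascend_loop ::
  "'a::field mat \<Rightarrow> 'a poly \<Rightarrow> nat list \<Rightarrow> 'a vec \<Rightarrow> (nat option \<times> 'a vec) counted" where
  "ascend_loop A p [] v = ret (None, v)"
| "ascend_loop A p (l # ls) v =
     do { w \<leftarrow> horner_op (mat_vec_op A) p v;
          if w = 0\<^sub>v (dim_row A) then ret (Some l, w) else ascend_loop A p ls w }"

text \<open>Multiplies \<open>v\<close> by the factors in turn until it vanishes, and returns the \<open>i\<close> at which this
  happens. The first equation is never reached from
  the full list \<open>1, \<dots>, q\<close>, since the characteristic polynomial annihilates \<open>e\<^sub>j\<close>.\<close>

primrec ascend ::
  "'a::field mat \<Rightarrow> (nat \<Rightarrow> 'a poly) \<Rightarrow> (nat \<Rightarrow> nat) \<Rightarrow> (nat \<Rightarrow> nat) \<Rightarrow> nat list \<Rightarrow> 'a vec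
     \<Rightarrow> (nat \<Rightarrow> 'a vec) \<Rightarrow> (nat \<Rightarrow> nat) \<Rightarrow> (nat \<times> (nat \<Rightarrow> 'a vec) \<times> (nat \<Rightarrow> nat)) counted" where
  "ascend A f m \<rho> [] v vs r = ret (0, vs, r)"
| "ascend A f m \<rho> (i # is) v vs r =
     do { (stop, w) \<leftarrow> ascend_loop A (f i) [1..<Suc (m i - \<rho> i)] v;
          case stop of
            Some l \<Rightarrow>
              do { vs' \<leftarrow> update_vecs A (f i) l (rev [0..<i]) (vs(i := 0\<^sub>v (dim_row A)));
                   ret (i, vs', r(i := \<rho> i + l)) }
          | None \<Rightarrow> ascend A f m \<rho> is w (vs(i := w)) r }"

primrec descend_loop ::
  "'a::field mat \<Rightarrow> 'a poly \<Rightarrow> nat \<Rightarrow> nat list \<Rightarrow> 'a vec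
     \<Rightarrow> (nat \<Rightarrow> 'a vec) \<Rightarrow> (nat \<Rightarrow> nat) \<Rightarrow> ((nat \<Rightarrow> 'a vec) \<times> (nat \<Rightarrow> nat)) counted" where
  "descend_loop A p k [] v vs r = ret (vs, r)"
| "descend_loop A p k (l # ls) v vs r =
     (if v = 0\<^sub>v (dim_row A)
      then do { vs' \<leftarrow> update_vecs A p l (rev [0..<k - 1]) vs; ret (vs', r) }
      else do { w \<leftarrow> horner_op (mat_vec_op A) p v;
                descend_loop A p k ls w vs (r(k := r k + 1)) })"

text \<open>The loop over \<open>l\<close> runs up to \<open>m k - \<rho> k\<close>, not only up to \<open>m k - \<rho> k - 1\<close>: in
  the last pass \<open>v\<close> is already zero, so the pass only performs the update of
  \<open>v\<^sub>k\<^sub>-\<^sub>2, \<dots>, v\<^sub>0\<close>. Without it these vectors would miss the factor \<open>f k ^ (m k - \<rho> k)\<close>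
  whenever \<open>f k\<close> is needed with the full exponent \<open>m k\<close>, and the exponents of
  \<open>f (k - 1), \<dots>, f 1\<close> could come out too large.\<close>

primrec descend ::
  "'a::field mat \<Rightarrow> (nat \<Rightarrow> 'a poly) \<Rightarrow> (nat \<Rightarrow> nat) \<Rightarrow> (nat \<Rightarrow> nat) \<Rightarrow> nat list
     \<Rightarrow> (nat \<Rightarrow> 'a vec) \<Rightarrow> (nat \<Rightarrow> nat) \<Rightarrow> (nat \<Rightarrow> nat) counted" where
  "descend A f m \<rho> [] vs r = ret r"
| "descend A f m \<rho> (k # ks) vs r =
     do { (vs', r') \<leftarrow> descend_loop A (f k) k [0..<Suc (m k - \<rho> k)] (vs (k - 1)) vs r;
          descend A f m \<rho> ks vs' r' }"

definition unit_min_exponents ::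
  "'a::field mat \<Rightarrow> nat \<Rightarrow> (nat \<Rightarrow> 'a poly) \<Rightarrow> (nat \<Rightarrow> nat) \<Rightarrow> (nat \<Rightarrow> nat) \<Rightarrow> nat
     \<Rightarrow> (nat \<Rightarrow> nat) counted" where
  "unit_min_exponents A q f m \<rho> j =
     do { v \<leftarrow> apply_factors (mat_vec_op A) f \<rho> [1..<Suc q] (unit_vec (dim_row A) j);
          if v = 0\<^sub>v (dim_row A) then ret \<rho>
          else do { (i, vs, r) \<leftarrow> ascend A f m \<rho> [1..<Suc q] v (\<lambda>_. v) \<rho>;
                    descend A f m \<rho> (rev [1..<i]) vs r } }"

text \<open>The result maps \<open>i\<close> and \<open>j\<close> to the exponent \<open>r\<^sub>i\<^sub>j\<close> found for \<open>f i\<close>.\<close>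

definition alg_min ::
  "'a::field mat \<Rightarrow> nat \<Rightarrow> (nat \<Rightarrow> 'a poly) \<Rightarrow> (nat \<Rightarrow> nat) \<Rightarrow> 'a vec
     \<Rightarrow> (nat \<Rightarrow> nat \<Rightarrow> nat) counted" where
  "alg_min A q f m u =
     do { \<rho> \<leftarrow> alg_pseudo A q f m u;
          rs \<leftarrow> map_counted (\<lambda>j. unit_min_exponents A q f m (\<lambda>i. \<rho> i j) j) [0..<dim_row A];
          ret (\<lambda>i j. (rs ! j) i) }"


section \<open>The bound\<close>

definition pseudo_exponent ::
  "'a::field mat \<Rightarrow> nat \<Rightarrow> (nat \<Rightarrow> 'a poly) \<Rightarrow> (nat \<Rightarrow> nat) \<Rightarrow> 'a vec \<Rightarrow> nat \<Rightarrow> nat \<Rightarrow> nat" where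
  "pseudo_exponent A q f m u = result (alg_pseudo A q f m u)"

definition unit_pseudo_poly ::
  "'a::field mat \<Rightarrow> nat \<Rightarrow> (nat \<Rightarrow> 'a poly) \<Rightarrow> (nat \<Rightarrow> nat) \<Rightarrow> 'a vec \<Rightarrow> nat \<Rightarrow> 'a poly" where
  "unit_pseudo_poly A q f m u j = (\<Prod>i=1..q. f i ^ pseudo_exponent A q f m u i j)"

definition unit_exponent :: "'a::field mat \<Rightarrow> (nat \<Rightarrow> 'a poly) \<Rightarrow> nat \<Rightarrow> nat \<Rightarrow> nat" where
  "unit_exponent A f i j = (GREATEST k. f i ^ k dvd unit_min_poly A j)"

text \<open>The value \<open>0\<close> stands for the case that there is no index with \<open>\<rho>\<^sub>i\<^sub>j < r\<^sub>i\<^sub>j\<close>.\<close>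

definition last_deficient ::
  "'a::field mat \<Rightarrow> nat \<Rightarrow> (nat \<Rightarrow> 'a poly) \<Rightarrow> (nat \<Rightarrow> nat) \<Rightarrow> 'a vec \<Rightarrow> nat \<Rightarrow> nat" where
  "last_deficient A q f m u j =
     Max (insert 0 {i \<in> {1..q}. pseudo_exponent A q f m u i j < unit_exponent A f i j})"

definition ops_bound ::
  "'a::field mat \<Rightarrow> nat \<Rightarrow> (nat \<Rightarrow> 'a poly) \<Rightarrow> (nat \<Rightarrow> nat) \<Rightarrow> 'a vec \<Rightarrow> real" where
  "ops_bound A q f m u =
     (let n = real (dim_row A);
          \<rho> = (\<lambda>i j. real (pseudo_exponent A q f m u i j));
          \<delta> = (\<lambda>i j. real (unit_exponent A f i j) - \<rho> i j)
      in n ^ 3 * max 1 (log 2 (real q))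
         + n ^ 2 * real (degree (min_poly A))
         + n ^ 2 * (\<Sum>j<dim_row A. real (degree (unit_pseudo_poly A q f m u j)))
         + n ^ 2 * (\<Sum>j<dim_row A. \<Sum>k=1..last_deficient A q f m u j.
                      real (degree (f k)) * ((real (m k) - \<rho> k j) + real k * \<delta> k j)))"

end

(*
  The polynomials act on vectors by p(A), and e_j is annihilated exactly by the multiples of
  pi_{A,j}, which divides chi_A by Cayley-Hamilton. Hence a vector f_1^{e_1} ... f_q^{e_q}(A) e_j
  is zero if and only if r_{i,j} <= e_i for all i, and Algorithm M can be followed on exponent
  vectors alone. All that correctness needs from Algorithm P is rho_{i,j} <= r_{i,j}: the row
  vector u g_i(A) f_i(A)^{r_{i,j}} has j-th entry 0.

  One application of f_i(A) costs at most 5 n^2 d_i operations. Each level of the splitting tree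
  applies every f_i at most m_i times, hence costs at most 5 n^3, and so do all passes of
  Algorithm P together. Step (2) stops exactly at i = q''_j after m_k - rho_k applications of f_k
  for k < i and delta_i at i, plus i delta_i for the update; step (3) uses delta_k applications
  of f_k to find r_k and (k - 1) delta_k for the update.
*)

theory Submission
  imports Defs
begin

section \<open>Polynomials in a matrix\<close>

text \<open>Algorithm M stores the vectors \<open>v_k\<close> so that a single exponent can be
  tested in isolation. In \<open>v_(k-1)\<close> the factors before \<open>f k\<close> carry their
  full exponents \<open>m\<close>, so they can never be the reason why the vector is nonzero. Once
  the factors after \<open>f k\<close> carry their exact exponents, \<open>f k\<close> alone decides
  whether the vector vanishes, and the first zero reveals its exponent. This separation has a price:
  each exponent that has been found must also be raised in every vector still to be used. That is
  the origin of the weight \<open>k\<close> in front of \<delta>_k in the bound, while the part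
  without weight comes from the ascent, which raises the factors one after another to
  \<open>m\<close> until the vector vanishes. On the side of Algorithm P, row vectors are treated as
  columns under the transposed matrix, so both directions of multiplication share the same lemmas on
  Horner's rule.\<close>

lemma poly_mat_carrier [simp]: "A \<in> carrier_mat n n \<Longrightarrow> poly_mat p A \<in> carrier_mat n n"
  by (auto simp: poly_mat_def)

lemma dim_poly_mat [simp]:
  "dim_row (poly_mat p A) = dim_row A" "dim_col (poly_mat p A) = dim_row A"
  by (auto simp: poly_mat_def)

text \<open>\<open>poly_mat\<close> sums only up to the degree of its polynomial. A freely chosen
  bound \<open>N\<close> lets polynomials of different degrees be compared entry by entry.\<close>

lemma index_poly_mat:
  assumes "A \<in> carrier_mat n n" "i < n" "j < n" "degree p \<le> N"
  shows "poly_mat p A $$ (i, j) = (\<Sum>k\<le>N. coeff p k * (A ^\<^sub>m k) $$ (i, j))"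
proof -
  have "(\<Sum>k\<le>N. coeff p k * (A ^\<^sub>m k) $$ (i, j)) = (\<Sum>k\<le>degree p. coeff p k * (A ^\<^sub>m k) $$ (i, j))"
    by (rule sum.mono_neutral_right) (use assms in \<open>auto simp: coeff_eq_0\<close>)
  then show ?thesis using assms by (simp add: poly_mat_def)
qed

lemma poly_mat_0: "A \<in> carrier_mat n n \<Longrightarrow> poly_mat 0 A = 0\<^sub>m n n"
  by (intro eq_matI) (auto simp: poly_mat_def)

lemma poly_mat_add:
  assumes "A \<in> carrier_mat n n"
  shows "poly_mat (p + q) A = poly_mat p A + poly_mat q A"
proof (rule eq_matI)
  fix i j assume "i < dim_row (poly_mat p A + poly_mat q A)" "j < dim_col (poly_mat p A + poly_mat q A)"
  then have ij: "i < n" "j < n" using assms by auto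
  let ?N = "max (degree p) (degree q)"
  have "degree (p + q) \<le> ?N" by (rule degree_add_le_max)
  then show "poly_mat (p + q) A $$ (i, j) = (poly_mat p A + poly_mat q A) $$ (i, j)"
    using assms ij
    by (simp add: index_poly_mat[where N = ?N] distrib_right sum.distrib)
qed (use assms in auto)

lemma poly_mat_smult:
  assumes "A \<in> carrier_mat n n"
  shows "poly_mat (Polynomial.smult c p) A = c \<cdot>\<^sub>m poly_mat p A"
proof (rule eq_matI)
  fix i j assume "i < dim_row (c \<cdot>\<^sub>m poly_mat p A)" "j < dim_col (c \<cdot>\<^sub>m poly_mat p A)"
  then have ij: "i < n" "j < n" using assms by auto
  then show "poly_mat (Polynomial.smult c p) A $$ (i, j) = (c \<cdot>\<^sub>m poly_mat p A) $$ (i, j)"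
    using assms by (simp add: index_poly_mat[where N = "degree p"] degree_smult_le sum_distrib_left mult.assoc)
qed (use assms in auto)

text \<open>\<open>pow_mat\<close> adds the new factor on the right, whereas Horner's rule
  multiplies from the left.\<close>

lemma pow_mat_Suc_left:
  assumes A: "A \<in> carrier_mat n n"
  shows "A ^\<^sub>m Suc k = A * A ^\<^sub>m k"
proof (induction k)
  case 0
  then show ?case using A by simp
next
  case (Suc k)
  have "A ^\<^sub>m Suc (Suc k) = (A * A ^\<^sub>m k) * A" using Suc by simp
  also have "\<dots> = A * (A ^\<^sub>m k * A)" by (rule assoc_mult_mat) (use A in auto)
  finally show ?case by simp
qed

text \<open>This is Horner's recursion. It carries the induction for multiplicativity and, applied
  to a vector, the correctness of \<open>horner_coeffs\<close>.\<close>

lemma poly_mat_pCons: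
  assumes A: "A \<in> carrier_mat n n"
  shows "poly_mat (pCons c p) A = c \<cdot>\<^sub>m 1\<^sub>m n + A * poly_mat p A"
proof (rule eq_matI)
  fix i j assume "i < dim_row (c \<cdot>\<^sub>m 1\<^sub>m n + A * poly_mat p A)" "j < dim_col (c \<cdot>\<^sub>m 1\<^sub>m n + A * poly_mat p A)"
  then have ij: "i < n" "j < n" using A by auto
  have idx: "(A * M) $$ (i, j) = (\<Sum>l<n. A $$ (i, l) * M $$ (l, j))" if "M \<in> carrier_mat n n" for M
    using A ij that by (auto simp: scalar_prod_def atLeast0LessThan)
  have "poly_mat (pCons c p) A $$ (i, j)
      = c * 1\<^sub>m n $$ (i, j) + (\<Sum>k\<le>degree p. coeff p k * (A * A ^\<^sub>m k) $$ (i, j))"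
    using A ij
    by (simp add: index_poly_mat[where N = "Suc (degree p)"] degree_pCons_le sum.atMost_Suc_shift
        pow_mat_Suc_left[symmetric] del: pow_mat.simps(2) sum.atMost_Suc)
  also have "(\<Sum>k\<le>degree p. coeff p k * (A * A ^\<^sub>m k) $$ (i, j))
      = (\<Sum>k\<le>degree p. \<Sum>l<n. A $$ (i, l) * (coeff p k * (A ^\<^sub>m k) $$ (l, j)))"
    using A by (simp add: idx sum_distrib_left mult.left_commute del: index_mult_mat)
  also have "\<dots> = (\<Sum>l<n. A $$ (i, l) * poly_mat p A $$ (l, j))"
    using A ij by (subst sum.swap) (simp add: index_poly_mat[where N = "degree p"] sum_distrib_left)
  also have "\<dots> = (A * poly_mat p A) $$ (i, j)" using A by (simp add: idx del: index_mult_mat)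
  finally show "poly_mat (pCons c p) A $$ (i, j) = (c \<cdot>\<^sub>m 1\<^sub>m n + A * poly_mat p A) $$ (i, j)"
    using A ij by simp
qed (use A in auto)

lemma poly_mat_const: "A \<in> carrier_mat n n \<Longrightarrow> poly_mat [:c:] A = c \<cdot>\<^sub>m 1\<^sub>m n"
  by (auto simp: poly_mat_pCons poly_mat_0)

lemma poly_mat_1: "A \<in> carrier_mat n n \<Longrightarrow> poly_mat 1 A = 1\<^sub>m n"
  using poly_mat_const[of A n 1] by (auto simp: one_pCons)

lemma poly_mat_mult:
  fixes A :: "'a::comm_ring_1 mat"
  assumes A: "A \<in> carrier_mat n n"
  shows "poly_mat (p * q) A = poly_mat p A * poly_mat q A"
proof (induction p)
  case 0
  then show ?case using A by (simp add: poly_mat_0)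
next
  case (pCons c p)
  let ?P = "poly_mat p A" and ?Q = "poly_mat q A"
  have smult_zero: "0 \<cdot>\<^sub>m 1\<^sub>m n = (0\<^sub>m n n :: 'a mat)" by auto
  have P: "?P \<in> carrier_mat n n" and Q: "?Q \<in> carrier_mat n n" using A by auto
  have add_zero: "0\<^sub>m n n + A * (?P * ?Q) = A * (?P * ?Q)"
    by (rule left_add_zero_mat) (use A P Q in \<open>auto intro!: mult_carrier_mat\<close>)
  have "(c \<cdot>\<^sub>m 1\<^sub>m n + A * ?P) * ?Q = (c \<cdot>\<^sub>m 1\<^sub>m n) * ?Q + A * ?P * ?Q"
    by (rule add_mult_distrib_mat) (use A P Q in auto)
  also have "(c \<cdot>\<^sub>m 1\<^sub>m n) * ?Q = c \<cdot>\<^sub>m ?Q"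
    using mult_smult_assoc_mat[of "1\<^sub>m n" n n ?Q n c] Q by (simp add: left_mult_one_mat[OF Q])
  also have "A * ?P * ?Q = A * (?P * ?Q)" by (rule assoc_mult_mat) (use A P Q in auto)
  also have "c \<cdot>\<^sub>m ?Q + A * (?P * ?Q) = poly_mat (pCons c p * q) A"
    using A P Q pCons.IH add_zero smult_zero
    by (simp add: mult_pCons_left poly_mat_add[OF A] poly_mat_smult[OF A] poly_mat_pCons[OF A])
  finally show ?case using A by (simp add: poly_mat_pCons)
qed

text \<open>Leads from the transpose, under which row vectors are iterated, back to polynomials in
  \<open>A\<close> itself, whose action on \<open>e_j\<close> is governed by the minimal
  annihilating polynomial.\<close>

lemma poly_mat_transpose:
  assumes A: "A \<in> carrier_mat n n"
  shows "poly_mat p (transpose_mat A) = transpose_mat (poly_mat p A)"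
proof -
  have AT: "transpose_mat A \<in> carrier_mat n n" using A by simp
  have pow: "transpose_mat A ^\<^sub>m k = transpose_mat (A ^\<^sub>m k)" for k
  proof (induction k)
    case 0
    then show ?case using A by simp
  next
    case (Suc k)
    have "transpose_mat (A ^\<^sub>m Suc k) = transpose_mat A * transpose_mat (A ^\<^sub>m k)"
      using A by (simp add: transpose_mult[of _ n n _ n])
    then show ?case using Suc pow_mat_Suc_left[OF AT, of k] by simp
  qed
  show ?thesis
    by (rule eq_matI) (use A AT in \<open>auto simp: poly_mat_def pow\<close>)
qed

lemma poly_mat_mult_vec:
  assumes "A \<in> carrier_mat n n" "v \<in> carrier_vec n"
  shows "poly_mat (p * q) A *\<^sub>v v = poly_mat p A *\<^sub>v (poly_mat q A *\<^sub>v v)"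
  unfolding poly_mat_mult[OF assms(1)] by (rule assoc_mult_mat_vec[of _ n n _ n]) (use assms in simp_all)

lemma poly_mat_pCons_vec:
  assumes A: "A \<in> carrier_mat n n" and v: "v \<in> carrier_vec n"
  shows "poly_mat (pCons c p) A *\<^sub>v v = c \<cdot>\<^sub>v v + A *\<^sub>v (poly_mat p A *\<^sub>v v)"
proof -
  have "poly_mat (pCons c p) A *\<^sub>v v = (c \<cdot>\<^sub>m 1\<^sub>m n) *\<^sub>v v + A * poly_mat p A *\<^sub>v v"
    using A v by (simp add: poly_mat_pCons add_mult_distrib_mat_vec[of _ n n])
  also have "(c \<cdot>\<^sub>m 1\<^sub>m n) *\<^sub>v v = c \<cdot>\<^sub>v v" using v by (intro eq_vecI) auto
  finally show ?thesis using A v by (simp add: assoc_mult_mat_vec[of _ n n _ n])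
qed

text \<open>Let a polynomial \<open>p\<close> act on vectors by \<open>p(A)\<close>. The columns of \<open>\<lambda>I - A\<close> are then relations
  among the unit vectors; multiplying these relations by the adjugate leaves the
  relations \<open>\<chi>\<^sub>A e\<^sub>k = 0\<close>.\<close>

theorem Cayley_Hamilton:
  fixes A :: "'a::comm_ring_1 mat"
  assumes A: "A \<in> carrier_mat n n"
  shows "poly_mat (char_poly A) A = 0\<^sub>m n n"
proof (rule eq_matI)
  let ?M = "char_poly_matrix A" and ?\<chi> = "char_poly A"
  let ?J = "adj_mat ?M"
  have M: "?M \<in> carrier_mat n n" using A by simp
  have J: "?J \<in> carrier_mat n n" by (rule adj_mat(1)[OF M])
  have P_sum: "poly_mat (\<Sum>j\<in>S. h j) A $$ (r, i) = (\<Sum>j\<in>S. poly_mat (h j) A $$ (r, i))"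
    if "r < n" "i < n" "finite S" for h and S :: "nat set" and r i
    using that(3)
    by (induction S) (use A that in \<open>auto simp: poly_mat_0 poly_mat_add\<close>)
  have P_mult: "poly_mat (g * h) A $$ (r, i) = (\<Sum>s<n. poly_mat g A $$ (r, s) * poly_mat h A $$ (s, i))"
    if "r < n" "i < n" for g h r i
    using A that by (simp add: poly_mat_mult scalar_prod_def atLeast0LessThan)
  \<comment> \<open>Column \<open>j\<close> of \<open>?M\<close> acts on the unit vectors as
    \<open>A e_j\<close> minus the sum of the \<open>A $$ (i, j) e_i\<close>, which is zero;
    \<open>s\<close> selects a coordinate.\<close>
  have rel: "(\<Sum>i<n. poly_mat (?M $$ (i, j)) A $$ (s, i)) = 0" if "s < n" "j < n" for s j
  proof -
    have "poly_mat (?M $$ (i, j)) A $$ (s, i) = (if i = j then A $$ (s, j) else 0) - (if i = s then A $$ (s, j) else 0)"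
      if "i < n" for i
    proof -
      have M_ij: "?M $$ (i, j) = [:- (A $$ (i, j)), if i = j then 1 else 0:]"
        using A that \<open>j < n\<close> by (simp add: char_poly_matrix_def)
      have "poly_mat [:- (A $$ (i, j)), if i = j then 1 else 0:] A $$ (s, i)
          = - (A $$ (i, j)) * (if s = i then 1 else 0) + (A * poly_mat [:if i = j then 1 else 0:] A) $$ (s, i)"
        using A that \<open>s < n\<close> by (subst poly_mat_pCons[OF A]) simp
      also have "A * poly_mat [:if i = j then 1 else 0:] A = (if i = j then A else 0\<^sub>m n n)"
        using A by (auto simp: poly_mat_1[unfolded one_pCons] poly_mat_0)
      finally show ?thesis using A that \<open>s < n\<close> M_ij by auto
    qed
    then have "(\<Sum>i<n. poly_mat (?M $$ (i, j)) A $$ (s, i))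
       = (\<Sum>i<n. (if i = j then A $$ (s, j) else 0)) - (\<Sum>i<n. (if i = s then A $$ (s, j) else 0))"
      by (simp add: sum_subtractf)
    also have "\<dots> = 0" using that by simp
    finally show ?thesis .
  qed
  fix r k assume "r < dim_row (0\<^sub>m n n :: 'a mat)" "k < dim_col (0\<^sub>m n n :: 'a mat)"
  then have rk: "r < n" "k < n" by auto
  have MJ: "(\<Sum>j<n. ?M $$ (i, j) * ?J $$ (j, k)) = (if i = k then ?\<chi> else 0)" if "i < n" for i
  proof -
    have "(?M * ?J) $$ (i, k) = (det ?M \<cdot>\<^sub>m 1\<^sub>m n) $$ (i, k)" by (simp only: adj_mat(2)[OF M])
    then show ?thesis using M J that rk by (simp add: scalar_prod_def atLeast0LessThan char_poly_def)
  qed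
  have "poly_mat ?\<chi> A $$ (r, k) = (\<Sum>i<n. if i = k then poly_mat ?\<chi> A $$ (r, k) else 0)"
    using rk by simp
  \<comment> \<open>The Kronecker delta is traded for the product of \<open>?M\<close> with its
    adjugate. After the swaps the sum over \<open>i\<close> stands innermost and is an instance of
    \<open>rel\<close>.\<close>
  also have "\<dots> = (\<Sum>i<n. poly_mat (\<Sum>j<n. ?M $$ (i, j) * ?J $$ (j, k)) A $$ (r, i))"
    using rk A by (intro sum.cong) (auto simp: MJ poly_mat_0)
  also have "\<dots> = (\<Sum>i<n. \<Sum>j<n. \<Sum>s<n. poly_mat (?J $$ (j, k)) A $$ (r, s) * poly_mat (?M $$ (i, j)) A $$ (s, i))"
    using rk by (simp add: P_sum P_mult mult.commute[of "?M $$ _"])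
  also have "\<dots> = (\<Sum>j<n. \<Sum>i<n. \<Sum>s<n. poly_mat (?J $$ (j, k)) A $$ (r, s) * poly_mat (?M $$ (i, j)) A $$ (s, i))"
    by (rule sum.swap)
  also have "\<dots> = (\<Sum>j<n. \<Sum>s<n. \<Sum>i<n. poly_mat (?J $$ (j, k)) A $$ (r, s) * poly_mat (?M $$ (i, j)) A $$ (s, i))"
    by (intro sum.cong refl sum.swap)
  also have "\<dots> = 0" by (simp add: sum_distrib_left[symmetric] rel)
  finally show "poly_mat ?\<chi> A $$ (r, k) = 0\<^sub>m n n $$ (r, k)" using rk by simp
qed (use A in auto)


section \<open>Factorizations into distinct monic irreducible polynomials\<close>

lemma monic_eq_if_dvd_dvd:
  fixes p q :: "'a::field poly"
  assumes "monic p" "monic q" "p dvd q" "q dvd p"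
  shows "p = q"
  by (rule poly_dvd_antisym) (use assms in simp_all)

lemma monic_prod_power:
  fixes f :: "nat \<Rightarrow> 'a::field poly"
  assumes "\<And>i. i \<in> S \<Longrightarrow> monic (f i)"
  shows "monic (\<Prod>i\<in>S. f i ^ e i)"
  by (rule monic_prod, rule monic_power, rule assms)

lemma degree_prod_power:
  fixes f :: "nat \<Rightarrow> 'a::field poly"
  assumes "\<And>i. i \<in> S \<Longrightarrow> monic (f i)"
  shows "degree (\<Prod>i\<in>S. f i ^ e i) = (\<Sum>i\<in>S. e i * degree (f i))"
proof (cases "finite S")
  case True
  then show ?thesis using assms
  proof (induction S)
    case empty
    then show ?case by simp
  next
    case (insert i S)
    have "monic (f i ^ e i)" "monic (\<Prod>i\<in>S. f i ^ e i)"
      using insert.prems by (auto intro: monic_power monic_prod_power)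
    then have "(\<Prod>i\<in>S. f i ^ e i) \<noteq> 0" by auto
    moreover have fi: "f i \<noteq> 0" using insert.prems[of i] by auto
    moreover have "f i ^ e i \<noteq> 0" using fi by simp
    ultimately show ?case
      using insert by (simp add: degree_mult_eq degree_power_eq)
  qed
qed simp

text \<open>Between irreducibles divisibility goes both ways, and monic associates coincide.\<close>

lemma monic_irreducible_not_dvd:
  fixes f :: "nat \<Rightarrow> 'a::field poly"
  assumes "\<And>i. i \<in> S \<Longrightarrow> monic (f i) \<and> irreducible (f i)" "inj_on f S" "i \<in> S" "j \<in> S" "i \<noteq> j"
  shows "\<not> f i dvd f j"
proof
  assume dvd: "f i dvd f j"
  have "f j dvd f i"
    using irreducibleD'[OF _ dvd] irreducible_not_unit assms by blast
  then have "f i = f j" using monic_eq_if_dvd_dvd dvd assms by blast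
  then show False using assms by (auto dest: inj_onD)
qed

lemma prime_elem_dvd_prod:
  assumes "finite S" and p: "prime_elem p" and "p dvd prod g S"
  shows "\<exists>i\<in>S. p dvd g i"
  using assms(1,3)
proof (induction S)
  case empty
  then show ?case using prime_elem_not_unit[OF p] by simp
next
  case (insert x S)
  then show ?case using prime_elem_dvd_multD[OF p, of "g x" "prod g S"] by auto
qed

text \<open>If \<open>k\<close> exceeded \<open>e i\<close>, cancelling \<open>f i ^ e i\<close>
  would make the prime \<open>f i\<close> divide a product of powers of the other factors, hence one
  of these factors.\<close>

lemma irreducible_power_dvd_prod_power_iff:
  fixes f :: "nat \<Rightarrow> 'a::field poly"
  assumes f: "\<And>i. i \<in> S \<Longrightarrow> monic (f i) \<and> irreducible (f i)" "inj_on f S" "finite S" and i: "i \<in> S"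
  shows "f i ^ k dvd (\<Prod>i\<in>S. f i ^ e i) \<longleftrightarrow> k \<le> e i"
proof
  assume "k \<le> e i"
  then have "f i ^ k dvd f i ^ e i" by (rule le_imp_power_dvd)
  also have "\<dots> dvd (\<Prod>i\<in>S. f i ^ e i)" using i f(3) by (rule dvd_prodI[rotated])
  finally show "f i ^ k dvd (\<Prod>i\<in>S. f i ^ e i)" .
next
  assume dvd: "f i ^ k dvd (\<Prod>i\<in>S. f i ^ e i)"
  show "k \<le> e i"
  proof (rule ccontr)
    assume "\<not> k \<le> e i"
    then have "f i ^ Suc (e i) dvd f i ^ k" by (intro le_imp_power_dvd) simp
    also note dvd
    also have "(\<Prod>i\<in>S. f i ^ e i) = f i ^ e i * (\<Prod>j\<in>S - {i}. f j ^ e j)"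
      using i f(3) by (rule prod.remove[rotated])
    finally have "f i ^ e i * f i dvd f i ^ e i * (\<Prod>j\<in>S - {i}. f j ^ e j)" by (simp add: mult.commute)
    moreover have "f i \<noteq> 0" using f i by auto
    ultimately have d: "f i dvd (\<Prod>j\<in>S - {i}. f j ^ e j)" by simp
    have prime: "prime_elem (f i)" using f i by (intro field_poly_irreducible_imp_prime) auto
    obtain j where j: "j \<in> S - {i}" "f i dvd f j ^ e j"
      using prime_elem_dvd_prod[OF _ prime d] f(3) by blast
    then have "f i dvd f j" using prime prime_elem_dvd_power by blast
    then show False using monic_irreducible_not_dvd[of S f i j] f i j by auto
  qed
qed

lemma prod_power_dvd_prod_power_iff:
  fixes f :: "nat \<Rightarrow> 'a::field poly"
  assumes f: "\<And>i. i \<in> S \<Longrightarrow> monic (f i) \<and> irreducible (f i)" "inj_on f S" "finite S"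
  shows "(\<Prod>i\<in>S. f i ^ r i) dvd (\<Prod>i\<in>S. f i ^ e i) \<longleftrightarrow> (\<forall>i\<in>S. r i \<le> e i)"
proof
  assume dvd: "(\<Prod>i\<in>S. f i ^ r i) dvd (\<Prod>i\<in>S. f i ^ e i)"
  show "\<forall>i\<in>S. r i \<le> e i"
  proof
    fix i assume i: "i \<in> S"
    then have "f i ^ r i dvd (\<Prod>i\<in>S. f i ^ r i)" using f(3) by (rule dvd_prodI[rotated])
    also note dvd
    finally show "r i \<le> e i" using irreducible_power_dvd_prod_power_iff[of S f i "r i" e, OF f i] by blast
  qed
next
  assume le: "\<forall>i\<in>S. r i \<le> e i"
  show "(\<Prod>i\<in>S. f i ^ r i) dvd (\<Prod>i\<in>S. f i ^ e i)"
    by (rule prod_dvd_prod, rule le_imp_power_dvd, rule bspec[OF le])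
qed

text \<open>Unique factorization relative to the given \<open>f i\<close>. The induction removes one
  factor \<open>f i\<close> at a time from the product; being prime, it divides either
  \<open>p\<close> or the cofactor. Thus \<open>p\<close> itself never has to be factored.\<close>

lemma monic_dvd_prod_powerE:
  fixes f :: "nat \<Rightarrow> 'a::field poly"
  assumes f: "\<And>i. i \<in> S \<Longrightarrow> monic (f i) \<and> irreducible (f i)" "finite S"
    and p: "monic p" "p dvd (\<Prod>i\<in>S. f i ^ m i)"
  obtains r where "p = (\<Prod>i\<in>S. f i ^ r i)" "\<And>i. i \<in> S \<Longrightarrow> r i \<le> m i"
proof -
  have "\<exists>r. p = (\<Prod>i\<in>S. f i ^ r i) \<and> (\<forall>i\<in>S. r i \<le> m i)"
    using p
  proof (induction "\<Sum>i\<in>S. m i" arbitrary: m p)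
    case 0
    then have "p dvd 1" using f(2) by simp
    then have "p = 1" using 0 monic_eq_if_dvd_dvd[of p 1] by auto
    then show ?case by (intro exI[of _ "\<lambda>_. 0"]) auto
  next
    case (Suc N)
    then obtain i where i: "i \<in> S" "m i \<noteq> 0" by (metis nat.distinct(1) sum.neutral)
    define m' where "m' = m(i := m i - 1)"
    have fi: "monic (f i)" "f i \<noteq> 0" using f i by auto
    have upd: "(\<Prod>s\<in>S. f s ^ (e(i := Suc (e i))) s) = f i * (\<Prod>s\<in>S. f s ^ e s)" for e
    proof -
      have "(\<Prod>s\<in>S. f s ^ (e(i := Suc (e i))) s) = f i ^ Suc (e i) * (\<Prod>s\<in>S - {i}. f s ^ (e(i := Suc (e i))) s)"
        using i(1) f(2) by (subst prod.remove) auto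
      also have "(\<Prod>s\<in>S - {i}. f s ^ (e(i := Suc (e i))) s) = (\<Prod>s\<in>S - {i}. f s ^ e s)"
        by (intro prod.cong) auto
      finally show ?thesis using i(1) f(2) by (simp add: prod.remove[of S i])
    qed
    have m: "m = m'(i := Suc (m' i))" using i by (auto simp: m'_def)
    have "(\<Sum>s\<in>S. m s) = Suc (\<Sum>s\<in>S. m' s)"
      unfolding m using i f(2) by (simp add: sum.remove[of S i])
    then have N: "N = (\<Sum>s\<in>S. m' s)" using Suc by simp
    obtain c where c: "f i * (\<Prod>s\<in>S. f s ^ m' s) = p * c" using Suc.prems(2) upd[of m'] m by (metis dvdE)
    have prime: "prime_elem (f i)" using f i by (intro field_poly_irreducible_imp_prime) auto
    have "f i dvd p * c" using c by (metis dvd_triv_left)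
    then consider "f i dvd p" | "f i dvd c" using prime prime_elem_dvd_mult_iff by blast
    then show ?case
    proof cases
      case 1
      then obtain p' where p': "p = f i * p'" by (elim dvdE)
      have "(\<Prod>s\<in>S. f s ^ m' s) = p' * c" using c p' fi by (simp add: mult.assoc)
      then have "p' dvd (\<Prod>s\<in>S. f s ^ m' s)" by simp
      moreover have "monic p'" using p' fi Suc.prems(1) by (simp add: lead_coeff_mult)
      ultimately obtain r where r: "p' = (\<Prod>s\<in>S. f s ^ r s)" "\<forall>s\<in>S. r s \<le> m' s" using Suc.hyps(1)[OF N] by blast
      show ?thesis
        using r p' upd[of r] by (intro exI[of _ "r(i := Suc (r i))"]) (auto simp: m)
    next
      case 2
      then obtain c' where c': "c = f i * c'" by (elim dvdE)
      have "(\<Prod>s\<in>S. f s ^ m' s) = p * c'" using c c' fi by (simp add: mult.left_commute)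
      then have "p dvd (\<Prod>s\<in>S. f s ^ m' s)" by simp
      then obtain r where r: "p = (\<Prod>s\<in>S. f s ^ r s)" "\<forall>s\<in>S. r s \<le> m' s" using Suc.hyps(1)[OF N] Suc.prems by blast
      have "r s \<le> m s" if "s \<in> S" for s
        using r(2)[rule_format, OF that] by (simp add: m'_def split: if_splits)
      then show ?thesis using r(1) by blast
    qed
  qed
  then show thesis using that by blast
qed


section \<open>Generators of annihilator ideals\<close>

text \<open>\<open>monic_generator\<close> is a definite description, so it says nothing before
  existence and uniqueness are established. Existence is division with remainder by an element of
  least degree, which needs a nonzero element; uniqueness holds because monic polynomials dividing
  each other are equal.\<close>

lemma monic_generator_dvd_iff:
  fixes I :: "'a::field poly set"
  assumes nz: "p \<in> I" "p \<noteq> 0" and add: "\<And>g h. g \<in> I \<Longrightarrow> h \<in> I \<Longrightarrow> g + h \<in> I"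
    and mult: "\<And>g h. g \<in> I \<Longrightarrow> h * g \<in> I"
  shows "monic (monic_generator I)" "g \<in> I \<longleftrightarrow> monic_generator I dvd g"
proof -
  obtain d where d: "d \<in> I \<and> d \<noteq> 0" "\<And>g. g \<in> I \<and> g \<noteq> 0 \<Longrightarrow> degree d \<le> degree g"
    using ex_has_least_nat[of "\<lambda>g. g \<in> I \<and> g \<noteq> 0" p degree] nz by blast
  define D where "D = Polynomial.smult (inverse (lead_coeff d)) d"
  have "monic D" using d by (simp add: D_def)
  have "d dvd D" by (simp add: D_def dvd_smult)
  have "D dvd d" using d by (simp add: D_def smult_dvd_iff)
  have "g \<in> I \<longleftrightarrow> d dvd g" for g
  proof
    assume g: "g \<in> I"
    have "g mod d = g + (- (g div d)) * d" by (simp add: minus_div_mult_eq_mod[symmetric])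
    then have mod: "g mod d \<in> I" using add[OF g mult[of d "- (g div d)"]] d by simp
    show "d dvd g"
    proof (rule ccontr)
      assume "\<not> d dvd g"
      then have ne: "g mod d \<noteq> 0" by (simp add: dvd_eq_mod_eq_0)
      then have "degree (g mod d) < degree d" using degree_mod_less'[of d g] d by blast
      then show False using d(2)[of "g mod d"] mod ne by simp
    qed
  next
    assume "d dvd g"
    then obtain c where "g = c * d" by (metis dvdE mult.commute)
    then show "g \<in> I" using mult d by simp
  qed
  then have D: "I = {g. D dvd g}" using \<open>d dvd D\<close> \<open>D dvd d\<close> by (blast intro: dvd_trans)
  have "monic_generator I = D"
    unfolding monic_generator_def
  proof (rule the_equality)
    show "monic D \<and> I = {g. D dvd g}" using \<open>monic D\<close> D by simp
    fix E assume E: "monic E \<and> I = {g. E dvd g}"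
    have "D \<in> I" using D by simp
    then have "E dvd D" using E by blast
    have "E \<in> I" using E by simp
    then have "D dvd E" using D by blast
    show "E = D" using E \<open>monic D\<close> \<open>E dvd D\<close> \<open>D dvd E\<close> by (intro monic_eq_if_dvd_dvd) simp_all
  qed
  then show "monic (monic_generator I)" "g \<in> I \<longleftrightarrow> monic_generator I dvd g"
    using \<open>monic D\<close> D by simp_all
qed

text \<open>Cayley-Hamilton supplies the nonzero annihilator without which the ideal would have no
  monic generator.\<close>

lemma unit_min_poly:
  fixes A :: "'a::field mat"
  assumes A: "A \<in> carrier_mat n n"
  shows "monic (unit_min_poly A j)"
    "unit_min_poly A j dvd p \<longleftrightarrow> poly_mat p A *\<^sub>v unit_vec n j = 0\<^sub>v n"
    "unit_min_poly A j dvd char_poly A"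
proof -
  let ?I = "{p. poly_mat p A *\<^sub>v unit_vec (dim_row A) j = 0\<^sub>v (dim_row A)}"
  have n: "dim_row A = n" using A by simp
  have char: "char_poly A \<in> ?I" "char_poly A \<noteq> 0"
    using degree_monic_char_poly[OF A] A by (auto simp: Cayley_Hamilton)
  have add: "g + h \<in> ?I" if "g \<in> ?I" "h \<in> ?I" for g h
    using that A by (simp add: poly_mat_add add_mult_distrib_mat_vec[of _ n n])
  have mult: "h * g \<in> ?I" if "g \<in> ?I" for g h
    using that A by (auto simp: poly_mat_mult_vec)
  show "monic (unit_min_poly A j)"
    unfolding unit_min_poly_def by (rule monic_generator_dvd_iff[OF char add mult])
  show dvd: "unit_min_poly A j dvd p \<longleftrightarrow> poly_mat p A *\<^sub>v unit_vec n j = 0\<^sub>v n" for p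
    using monic_generator_dvd_iff(2)[of "char_poly A" ?I p] char add mult
    unfolding unit_min_poly_def n by blast
  show "unit_min_poly A j dvd char_poly A"
    using char A by (simp add: dvd)
qed


section \<open>Costs of the basic operations\<close>

lemma result_ret [simp]: "result (ret x) = x"
  and ops_ret [simp]: "ops (ret x) = 0"
  by (simp_all add: ret_def)

lemma result_bind [simp]: "result (counted_bind x g) = result (g (result x))"
  and ops_bind [simp]: "ops (counted_bind x g) = ops x + ops (g (result x))"
  by (simp_all add: counted_bind_def)

lemma result_map_counted [simp]: "result (map_counted g xs) = map (\<lambda>x. result (g x)) xs"
  by (induction xs) auto

lemma ops_map_counted [simp]: "ops (map_counted g xs) = (\<Sum>x\<leftarrow>xs. ops (g x))"
  by (induction xs) auto

lemma result_vec_counted: "result (vec_counted n g) = vec n (\<lambda>i. result (g i))"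
  by (rule eq_vecI) (auto simp: vec_counted_def vec_of_list_index simp del: upt_Suc vec_of_list_map)

lemma ops_vec_counted: "ops (vec_counted n g) = (\<Sum>i<n. ops (g i))"
  by (simp add: vec_counted_def interv_sum_list_conv_sum_set_nat atLeast0LessThan)

lemma result_scalar_prod_op: "result (scalar_prod_op v w) = v \<bullet> w"
proof -
  have "result (fold_counted (\<lambda>k s. counted_bind (mult_op (v $ k) (w $ k)) (\<lambda>t. add_op s t)) ks s)
      = s + (\<Sum>k\<leftarrow>ks. v $ k * w $ k)" for ks s
    by (induction ks arbitrary: s) (auto simp: mult_op_def add_op_def add.assoc)
  then show ?thesis
    by (simp add: scalar_prod_op_def scalar_prod_def interv_sum_list_conv_sum_set_nat)
qed

lemma ops_scalar_prod_op: "ops (scalar_prod_op v w) = 2 * dim_vec w"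
proof -
  have "ops (fold_counted (\<lambda>k s. counted_bind (mult_op (v $ k) (w $ k)) (\<lambda>t. add_op s t)) ks s)
      = 2 * length ks" for ks s
    by (induction ks arbitrary: s) (auto simp: mult_op_def add_op_def)
  then show ?thesis by (simp add: scalar_prod_op_def)
qed

text \<open>\<open>mult_by mul B n\<close> covers both \<^term>\<open>mat_vec_op A\<close>, with \<open>B = A\<close>, and \<^term>\<open>vec_mat_op A\<close>,
  with \<open>B = A\<^sup>T\<close>.\<close>

definition mult_by :: "('a::field vec \<Rightarrow> 'a vec counted) \<Rightarrow> 'a mat \<Rightarrow> nat \<Rightarrow> bool" where
  "mult_by mul B n \<longleftrightarrow> B \<in> carrier_mat n n \<and>
     (\<forall>v\<in>carrier_vec n. result (mul v) = B *\<^sub>v v \<and> ops (mul v) = 2 * n ^ 2)"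

lemma mult_byD:
  assumes "mult_by mul B n"
  shows "B \<in> carrier_mat n n"
    and "v \<in> carrier_vec n \<Longrightarrow> result (mul v) = B *\<^sub>v v"
    and "v \<in> carrier_vec n \<Longrightarrow> ops (mul v) = 2 * n ^ 2"
  using assms by (simp_all add: mult_by_def)

lemma mult_by_carrier:
  assumes "mult_by mul B n" "v \<in> carrier_vec n"
  shows "poly_mat p B *\<^sub>v v \<in> carrier_vec n"
  by (rule mult_mat_vec_carrier[OF poly_mat_carrier[OF mult_byD(1)[OF assms(1)]] assms(2)])

lemma mult_by_mat_vec_op:
  assumes "A \<in> carrier_mat n n"
  shows "mult_by (mat_vec_op A) A n"
  unfolding mult_by_def
proof (intro conjI ballI assms)
  fix v :: "'a vec" assume "v \<in> carrier_vec n"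
  then show "result (mat_vec_op A v) = A *\<^sub>v v" "ops (mat_vec_op A v) = 2 * n ^ 2"
    using assms
    by (simp_all add: mat_vec_op_def result_vec_counted result_scalar_prod_op
        ops_vec_counted ops_scalar_prod_op power2_eq_square mult_mat_vec_def)
qed

lemma mult_by_vec_mat_op:
  assumes "A \<in> carrier_mat n n"
  shows "mult_by (vec_mat_op A) (transpose_mat A) n"
proof -
  have "w \<bullet> col A j = col A j \<bullet> w" if "w \<in> carrier_vec n" for w j
    by (rule comm_scalar_prod) (use assms that in auto)
  then show ?thesis using assms
    by (auto simp: mult_by_def vec_mat_op_def result_vec_counted result_scalar_prod_op
        ops_vec_counted ops_scalar_prod_op power2_eq_square mult_mat_vec_def)
qed

lemma result_add_vec_op: "dim_vec v = dim_vec w \<Longrightarrow> result (add_vec_op v w) = v + w"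
  and ops_add_vec_op: "ops (add_vec_op v w) = dim_vec v"
  by (auto simp: add_vec_op_def result_vec_counted ops_vec_counted add_op_def)

lemma result_smult_vec_op: "result (smult_vec_op c v) = c \<cdot>\<^sub>v v"
  and ops_smult_vec_op: "ops (smult_vec_op c v) = dim_vec v"
  by (auto simp: smult_vec_op_def result_vec_counted ops_vec_counted mult_op_def)

lemma result_horner_coeffs:
  assumes "mult_by mul B n" "v \<in> carrier_vec n"
  shows "result (horner_coeffs mul cs v) = poly_mat (Poly cs) B *\<^sub>v v"
  using assms
proof (induction mul cs v rule: horner_coeffs.induct)
  case (1 mul v)
  then show ?case by (auto simp: poly_mat_0 mult_by_def)
next
  case (2 mul c v)
  have B: "B \<in> carrier_mat n n" using 2(1) by (rule mult_byD)
  have zero: "0\<^sub>m n n *\<^sub>v v = 0\<^sub>v n" "B *\<^sub>v 0\<^sub>v n = 0\<^sub>v n" using B 2(2) by auto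
  have "poly_mat [:c:] B *\<^sub>v v = c \<cdot>\<^sub>v v + B *\<^sub>v (0\<^sub>m n n *\<^sub>v v)"
    using B 2 by (simp only: poly_mat_pCons_vec poly_mat_0)
  also have "\<dots> = c \<cdot>\<^sub>v v"
    using 2(2) by (simp only: zero right_zero_vec smult_carrier_vec)
  finally show ?case by (simp add: result_smult_vec_op)
next
  case (3 mul c c' cs v)
  let ?w = "poly_mat (Poly (c' # cs)) B *\<^sub>v v"
  have B: "B \<in> carrier_mat n n" using 3(2) by (rule mult_byD)
  have w: "?w \<in> carrier_vec n" by (rule mult_by_carrier[OF 3(2,3)])
  have mul: "result (mul ?w) = B *\<^sub>v ?w" by (rule mult_byD(2)[OF 3(2) w])
  have "result (horner_coeffs mul (c # c' # cs) v) = result (add_vec_op (result (mul ?w)) (c \<cdot>\<^sub>v v))"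
    using 3(1)[OF 3(2,3)] by (simp add: result_smult_vec_op del: Poly.simps)
  also have "\<dots> = B *\<^sub>v ?w + c \<cdot>\<^sub>v v"
    unfolding mul by (rule result_add_vec_op) (use B 3(3) in simp)
  also have "\<dots> = c \<cdot>\<^sub>v v + B *\<^sub>v ?w"
    by (rule comm_add_vec[of _ n]) (use B w 3(3) in \<open>auto simp del: Poly.simps\<close>)
  also have "\<dots> = poly_mat (Poly (c # c' # cs)) B *\<^sub>v v"
    unfolding Poly.simps(2)[of c] by (rule poly_mat_pCons_vec[OF B 3(3), symmetric])
  finally show ?case .
qed

text \<open>Each coefficient except the leading one accounts for a product (\<open>2 n^2\<close>), a
  scaling and an addition (\<open>n\<close> each); the leading one is only scaled.\<close>

lemma ops_horner_coeffs:
  assumes "mult_by mul B n" "v \<in> carrier_vec n" "cs \<noteq> []"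
  shows "ops (horner_coeffs mul cs v) = (length cs - 1) * (2 * n ^ 2 + 2 * n) + n"
  using assms
proof (induction mul cs v rule: horner_coeffs.induct)
  case (3 mul c c' cs v)
  let ?w = "poly_mat (Poly (c' # cs)) B *\<^sub>v v"
  have B: "B \<in> carrier_mat n n" using 3(2) by (rule mult_byD)
  have w: "?w \<in> carrier_vec n" by (rule mult_by_carrier[OF 3(2,3)])
  have "result (mul ?w) = B *\<^sub>v ?w" "ops (mul ?w) = 2 * n ^ 2"
    by (rule mult_byD(2,3)[OF 3(2) w])+
  then show ?case
    using 3(1)[OF 3(2,3)] 3(3) B result_horner_coeffs[OF 3(2,3), of "c' # cs"]
    by (simp add: ops_smult_vec_op ops_add_vec_op del: Poly.simps)
qed (auto simp: ops_smult_vec_op)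

lemma result_horner_op:
  assumes "mult_by mul B n" "v \<in> carrier_vec n"
  shows "result (horner_op mul p v) = poly_mat p B *\<^sub>v v"
  using result_horner_coeffs[OF assms, of "coeffs p"] by (simp add: horner_op_def)

text \<open>Origin of the constant 5: by \<open>n \<le> n^2\<close> a Horner step costs at most
  \<open>4 n^2\<close>, and since the degree is positive, scaling by the leading coefficient fits
  into one further \<open>n^2 * degree p\<close>.\<close>

lemma ops_horner_op:
  assumes "mult_by mul B n" "v \<in> carrier_vec n" and deg: "1 \<le> degree p"
  shows "ops (horner_op mul p v) \<le> 5 * n ^ 2 * degree p"
proof -
  have "p \<noteq> 0" using deg by auto
  then have "ops (horner_op mul p v) = degree p * (2 * n ^ 2 + 2 * n) + n"
    using ops_horner_coeffs[OF assms(1,2), of "coeffs p"]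
    by (simp add: horner_op_def length_coeffs_degree)
  also have "\<dots> \<le> degree p * (2 * n ^ 2 + 2 * n ^ 2) + n ^ 2 * degree p"
  proof -
    have n: "n \<le> n ^ 2" by (simp add: power2_eq_square)
    also have "n ^ 2 \<le> n ^ 2 * degree p" using deg by simp
    finally show ?thesis using n by (intro add_mono mult_left_mono) auto
  qed
  finally show ?thesis by (simp add: algebra_simps)
qed

lemma result_apply_power:
  assumes "mult_by mul B n" "v \<in> carrier_vec n"
  shows "result (apply_power mul p l v) = poly_mat (p ^ l) B *\<^sub>v v"
  using assms(2)
proof (induction l arbitrary: v)
  case 0
  then show ?case using assms(1) by (simp add: poly_mat_1[of B n] mult_by_def)
next
  case (Suc l)
  have "result (apply_power mul p (Suc l) v) = poly_mat (p ^ l) B *\<^sub>v (poly_mat p B *\<^sub>v v)"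
    using Suc.IH[OF mult_by_carrier[OF assms(1) Suc.prems]] result_horner_op[OF assms(1) Suc.prems] by simp
  also have "\<dots> = poly_mat (p ^ l * p) B *\<^sub>v v"
    by (rule poly_mat_mult_vec[symmetric, of _ n]) (rule mult_byD[OF assms(1)] Suc.prems)+
  finally show ?case by (simp add: mult.commute)
qed

lemma ops_apply_power:
  assumes "mult_by mul B n" "v \<in> carrier_vec n" and deg: "1 \<le> degree p"
  shows "ops (apply_power mul p l v) \<le> 5 * n ^ 2 * (l * degree p)"
  using assms(2)
proof (induction l arbitrary: v)
  case (Suc l)
  have "ops (apply_power mul p (Suc l) v) \<le> 5 * n ^ 2 * degree p + 5 * n ^ 2 * (l * degree p)"
    using Suc.IH[OF mult_by_carrier[OF assms(1) Suc.prems]] result_horner_op[OF assms(1) Suc.prems]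
      ops_horner_op[OF assms(1) Suc.prems deg]
    by (simp add: add_mono)
  then show ?case by (simp add: algebra_simps)
qed simp

lemma result_apply_factors:
  assumes "mult_by mul B n" "v \<in> carrier_vec n"
  shows "result (apply_factors mul f e is v) = poly_mat (\<Prod>i\<leftarrow>is. f i ^ e i) B *\<^sub>v v"
  using assms(2)
proof (induction "is" arbitrary: v)
  case Nil
  then show ?case using assms(1) by (simp add: apply_factors_def poly_mat_1[of B n] mult_by_def)
next
  case (Cons i "is")
  have "result (apply_factors mul f e (i # is) v)
      = poly_mat (\<Prod>i\<leftarrow>is. f i ^ e i) B *\<^sub>v (poly_mat (f i ^ e i) B *\<^sub>v v)"
    using Cons.IH[OF mult_by_carrier[OF assms(1) Cons.prems]] result_apply_power[OF assms(1) Cons.prems]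
    by (simp add: apply_factors_def)
  also have "\<dots> = poly_mat ((\<Prod>i\<leftarrow>is. f i ^ e i) * f i ^ e i) B *\<^sub>v v"
    by (rule poly_mat_mult_vec[symmetric, of _ n]) (rule mult_byD[OF assms(1)] Cons.prems)+
  finally show ?case by (simp add: mult.commute)
qed

lemma ops_apply_factors:
  assumes "mult_by mul B n" "v \<in> carrier_vec n" "\<And>i. i \<in> set is \<Longrightarrow> 1 \<le> degree (f i)"
  shows "ops (apply_factors mul f e is v) \<le> 5 * n ^ 2 * (\<Sum>i\<leftarrow>is. e i * degree (f i))"
  using assms(2,3)
proof (induction "is" arbitrary: v)
  case Nil
  then show ?case by (simp add: apply_factors_def)
next
  case (Cons i "is")
  have "ops (apply_factors mul f e (i # is) v)
      \<le> 5 * n ^ 2 * (e i * degree (f i)) + 5 * n ^ 2 * (\<Sum>i\<leftarrow>is. e i * degree (f i))"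
    using Cons.IH[OF mult_by_carrier[OF assms(1) Cons.prems(1)]] result_apply_power[OF assms(1) Cons.prems(1)]
      ops_apply_power[OF assms(1) Cons.prems(1), of "f i" "e i"] Cons.prems(2)
    by (simp add: apply_factors_def add_mono)
  then show ?case by (simp add: algebra_simps)
qed


section \<open>Unit pseudo annihilating polynomials\<close>

lemma prod_list_upt: "(\<Prod>i\<leftarrow>[a..<b]. g i) = (\<Prod>i\<in>{a..<b}. g i :: 'a::comm_monoid_mult)"
  by (subst prod.distinct_set_conv_list[symmetric]) auto

lemma sum_list_upt: "(\<Sum>i\<leftarrow>[a..<b]. g i) = (\<Sum>i\<in>{a..<b}. g i :: 'a::comm_monoid_add)"
  by (subst sum.distinct_set_conv_list[symmetric]) auto

text \<open>Each child receives the factors of its sibling, so the two products at a node together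
  apply every factor of that node once. Nodes of one level are disjoint; hence a level costs no more
  than applying all factors once, and \<open>t\<close> bounds the number of levels below the
  root.\<close>

lemma split_vecs:
  assumes A: "A \<in> carrier_mat n n" and "v \<in> carrier_vec n" "a \<le> b"
    and "\<And>i. i \<in> {a..b} \<Longrightarrow> 1 \<le> degree (f i)"
  shows "result (split_vecs A f m a b v) =
      map (\<lambda>p. poly_mat (\<Prod>i\<in>{a..b} - {p}. f i ^ m i) (transpose_mat A) *\<^sub>v v) [a..<Suc b]"
    and "Suc (b - a) \<le> 2 ^ t \<Longrightarrow>
      ops (split_vecs A f m a b v) \<le> 5 * n ^ 2 * (t * (\<Sum>i=a..b. m i * degree (f i)))"
proof -
  have mul: "mult_by (vec_mat_op A) (transpose_mat A) n" using A by (rule mult_by_vec_mat_op)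
  have AT: "transpose_mat A \<in> carrier_mat n n" using A by simp
  let ?P = "\<lambda>S. poly_mat (\<Prod>i\<in>S. f i ^ m i) (transpose_mat A)"
  have "result (split_vecs A f m a b v) = map (\<lambda>p. ?P ({a..b} - {p}) *\<^sub>v v) [a..<Suc b] \<and>
      (\<forall>t. Suc (b - a) \<le> 2 ^ t \<longrightarrow>
        ops (split_vecs A f m a b v) \<le> 5 * n ^ 2 * (t * (\<Sum>i=a..b. m i * degree (f i))))"
    using assms(2-)
  proof (induction "b - a" arbitrary: a b v rule: less_induct)
    case less
    show ?case
    proof (cases "a = b")
      case True
      then show ?thesis using A less.prems by (simp add: poly_mat_1[OF AT])
    next
      case False
      define h where "h = a + (b - a) div 2"
      have h: "a \<le> h" "h < b" using False less.prems(2) by (auto simp: h_def)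
      define vl where "vl = result (apply_factors (vec_mat_op A) f m [Suc h..<Suc b] v)"
      define vr where "vr = result (apply_factors (vec_mat_op A) f m [a..<Suc h] v)"
      have vl: "vl = ?P {Suc h..b} *\<^sub>v v"
        unfolding vl_def result_apply_factors[OF mul less.prems(1)] prod_list_upt atLeastLessThanSuc_atLeastAtMost ..
      have vr: "vr = ?P {a..h} *\<^sub>v v"
        unfolding vr_def result_apply_factors[OF mul less.prems(1)] prod_list_upt atLeastLessThanSuc_atLeastAtMost ..
      have carrier: "vl \<in> carrier_vec n" "vr \<in> carrier_vec n"
        unfolding vl vr by (rule mult_by_carrier[OF mul less.prems(1)])+
      have split: "split_vecs A f m a b v =
          counted_bind (apply_factors (vec_mat_op A) f m [Suc h..<Suc b] v) (\<lambda>vl.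
          counted_bind (apply_factors (vec_mat_op A) f m [a..<Suc h] v) (\<lambda>vr.
          counted_bind (split_vecs A f m a h vl) (\<lambda>ls.
          counted_bind (split_vecs A f m (Suc h) b vr) (\<lambda>rs. ret (ls @ rs)))))"
        using False less.prems(2) by (subst split_vecs.simps) (simp add: Let_def h_def)
      have L: "result (split_vecs A f m a h vl) = map (\<lambda>p. ?P ({a..h} - {p}) *\<^sub>v vl) [a..<Suc h]"
        "\<And>t. Suc (h - a) \<le> 2 ^ t \<Longrightarrow> ops (split_vecs A f m a h vl) \<le> 5 * n ^ 2 * (t * (\<Sum>i=a..h. m i * degree (f i)))"
        using less.hyps[of h a vl] h carrier less.prems(3) by auto
      have R: "result (split_vecs A f m (Suc h) b vr) = map (\<lambda>p. ?P ({Suc h..b} - {p}) *\<^sub>v vr) [Suc h..<Suc b]"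
        "\<And>t. Suc (b - Suc h) \<le> 2 ^ t \<Longrightarrow> ops (split_vecs A f m (Suc h) b vr) \<le> 5 * n ^ 2 * (t * (\<Sum>i=Suc h..b. m i * degree (f i)))"
        using less.hyps[of b "Suc h" vr] h carrier less.prems(3) by auto
      have join: "?P S *\<^sub>v (?P T *\<^sub>v v) = ?P (S \<union> T) *\<^sub>v v" if "S \<inter> T = {}" "finite S" "finite T" for S T
        using poly_mat_mult_vec[OF AT less.prems(1)] that by (simp add: prod.union_disjoint)
      have joinL: "?P ({a..h} - {p}) *\<^sub>v vl = ?P ({a..b} - {p}) *\<^sub>v v" if "p \<in> {a..h}" for p
      proof -
        have "{a..b} - {p} = ({a..h} - {p}) \<union> {Suc h..b}" using that h by auto
        moreover have "?P ({a..h} - {p}) *\<^sub>v vl = ?P (({a..h} - {p}) \<union> {Suc h..b}) *\<^sub>v v"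
          unfolding vl by (rule join) auto
        ultimately show ?thesis by (simp only:)
      qed
      have joinR: "?P ({Suc h..b} - {p}) *\<^sub>v vr = ?P ({a..b} - {p}) *\<^sub>v v" if "p \<in> {Suc h..b}" for p
      proof -
        have "{a..b} - {p} = ({Suc h..b} - {p}) \<union> {a..h}" using that h by auto
        moreover have "?P ({Suc h..b} - {p}) *\<^sub>v vr = ?P (({Suc h..b} - {p}) \<union> {a..h}) *\<^sub>v v"
          unfolding vr by (rule join) auto
        ultimately show ?thesis by (simp only:)
      qed
      have "result (split_vecs A f m a b v)
          = map (\<lambda>p. ?P ({a..h} - {p}) *\<^sub>v vl) [a..<Suc h] @ map (\<lambda>p. ?P ({Suc h..b} - {p}) *\<^sub>v vr) [Suc h..<Suc b]"
        unfolding split result_bind vl_def[symmetric] vr_def[symmetric] L(1) R(1) result_ret ..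
      also have "map (\<lambda>p. ?P ({a..h} - {p}) *\<^sub>v vl) [a..<Suc h] = map (\<lambda>p. ?P ({a..b} - {p}) *\<^sub>v v) [a..<Suc h]"
        by (rule map_cong[OF refl], rule joinL) auto
      also have "map (\<lambda>p. ?P ({Suc h..b} - {p}) *\<^sub>v vr) [Suc h..<Suc b] = map (\<lambda>p. ?P ({a..b} - {p}) *\<^sub>v v) [Suc h..<Suc b]"
        by (rule map_cong[OF refl], rule joinR) auto
      also have "map (\<lambda>p. ?P ({a..b} - {p}) *\<^sub>v v) [a..<Suc h] @ map (\<lambda>p. ?P ({a..b} - {p}) *\<^sub>v v) [Suc h..<Suc b]
          = map (\<lambda>p. ?P ({a..b} - {p}) *\<^sub>v v) [a..<Suc b]"
        using h upt_add_eq_append[of a "Suc h" "b - h"] by (simp del: upt_Suc flip: map_append)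
      finally have result: "result (split_vecs A f m a b v) = map (\<lambda>p. ?P ({a..b} - {p}) *\<^sub>v v) [a..<Suc b]" .
      have "ops (split_vecs A f m a b v) \<le> 5 * n ^ 2 * (t * (\<Sum>i=a..b. m i * degree (f i)))"
        if t: "Suc (b - a) \<le> 2 ^ t" for t
      proof -
        have "t \<noteq> 0" using t h by (intro notI) simp
        then obtain t' where t': "t = Suc t'" by (cases t) auto
        \<comment> \<open>\<open>2 ^ t\<close> is even, so even the larger half of at most
          \<open>2 ^ t\<close> indices has at most \<open>2 ^ t'\<close> elements.\<close>
        have t_half: "Suc (h - a) \<le> 2 ^ t'" "Suc (b - Suc h) \<le> 2 ^ t'"
          using t h unfolding t' by (auto simp: h_def)
        let ?l = "\<Sum>i=a..h. m i * degree (f i)" and ?r = "\<Sum>i=Suc h..b. m i * degree (f i)"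
        have sum: "(\<Sum>i=a..b. m i * degree (f i)) = ?l + ?r"
          using h sum.ub_add_nat[of a h "\<lambda>i. m i * degree (f i)" "b - h"] by simp
        have fl: "ops (apply_factors (vec_mat_op A) f m [Suc h..<Suc b] v) \<le> 5 * n ^ 2 * ?r"
          by (rule ops_apply_factors[OF mul less.prems(1), of "[Suc h..<Suc b]" f m,
                unfolded sum_list_upt atLeastLessThanSuc_atLeastAtMost])
            (use h less.prems(3) in auto)
        have fr: "ops (apply_factors (vec_mat_op A) f m [a..<Suc h] v) \<le> 5 * n ^ 2 * ?l"
          by (rule ops_apply_factors[OF mul less.prems(1), of "[a..<Suc h]" f m,
                unfolded sum_list_upt atLeastLessThanSuc_atLeastAtMost])
            (use h less.prems(3) in auto)
        have "ops (split_vecs A f m a b v) = ops (apply_factors (vec_mat_op A) f m [Suc h..<Suc b] v)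
            + ops (apply_factors (vec_mat_op A) f m [a..<Suc h] v)
            + ops (split_vecs A f m a h vl) + ops (split_vecs A f m (Suc h) b vr)"
          unfolding split ops_bind vl_def[symmetric] vr_def[symmetric] ops_ret by simp
        also have "\<dots> \<le> 5 * n ^ 2 * ?r + 5 * n ^ 2 * ?l + 5 * n ^ 2 * (t' * ?l) + 5 * n ^ 2 * (t' * ?r)"
          by (intro add_mono fl fr L(2) R(2) t_half)
        also have "\<dots> = 5 * n ^ 2 * (t * (?l + ?r))" by (simp add: t' algebra_simps)
        finally show ?thesis by (simp only: sum)
      qed
      then show ?thesis using result by blast
    qed
  qed
  then show "result (split_vecs A f m a b v) = map (\<lambda>p. ?P ({a..b} - {p}) *\<^sub>v v) [a..<Suc b]"
    and "Suc (b - a) \<le> 2 ^ t \<Longrightarrow>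
      ops (split_vecs A f m a b v) \<le> 5 * n ^ 2 * (t * (\<Sum>i=a..b. m i * degree (f i)))"
    by blast+
qed

text \<open>As long as \<open>j\<close> is unset, \<open>r - k\<close> further applications would
  make its entry zero; at \<open>k = r\<close> the entry is zero already and gets set. If
  \<open>j\<close> is still unset at the end, all passes came before \<open>r\<close>, so the
  default \<open>m_i\<close> of Algorithm P obeys the same bound.\<close>

lemma pseudo_loop_le:
  assumes A: "A \<in> carrier_mat n n" and "b \<in> carrier_vec n" and j: "j < n"
    and "case s j of None \<Rightarrow> k \<le> r \<and> (poly_mat (p ^ (r - k)) (transpose_mat A) *\<^sub>v b) $ j = 0 | Some x \<Rightarrow> x \<le> r"
  shows "case result (pseudo_loop A p t k b s) j of None \<Rightarrow> k + t \<le> r | Some x \<Rightarrow> x \<le> r"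
  using assms(2,4)
proof (induction t arbitrary: k b s)
  case 0
  then show ?case by (auto split: option.splits)
next
  case (Suc t)
  have mul: "mult_by (vec_mat_op A) (transpose_mat A) n" using A by (rule mult_by_vec_mat_op)
  have AT: "transpose_mat A \<in> carrier_mat n n" using A by simp
  let ?b = "poly_mat p (transpose_mat A) *\<^sub>v b"
  let ?s = "\<lambda>j. if j < n \<and> s j = None \<and> b $ j = 0 then Some k else s j"
  show ?case
  proof (cases "b = 0\<^sub>v n \<and> (\<forall>j<n. s j \<noteq> None)")
    case True
    \<comment> \<open>The early exit occurs only when every exponent is set, so the
      \<open>None\<close> case is impossible here.\<close>
    then show ?thesis using A j Suc.prems(2) by (auto split: option.splits)
  next
    case False
    then have eq: "result (pseudo_loop A p (Suc t) k b s) = result (pseudo_loop A p t (Suc k) ?b ?s)"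
      using A Suc.prems(1) by (auto simp: result_horner_op[OF mul])
    have "case ?s j of None \<Rightarrow> Suc k \<le> r \<and> (poly_mat (p ^ (r - Suc k)) (transpose_mat A) *\<^sub>v ?b) $ j = 0 | Some x \<Rightarrow> x \<le> r"
    proof (cases "s j = None \<and> b $ j \<noteq> 0")
      case True
      then have k: "k \<le> r" "(poly_mat (p ^ (r - k)) (transpose_mat A) *\<^sub>v b) $ j = 0"
        using Suc.prems(2) by auto
      \<comment> \<open>At \<open>k = r\<close> the power is the identity, so the entry would be
        zero, contrary to the case assumption.\<close>
      have "k \<noteq> r" using k True Suc.prems(1) poly_mat_1[OF AT] by auto
      then have k': "Suc k \<le> r" "r - k = Suc (r - Suc k)" using k by auto
      have "poly_mat (p ^ (r - Suc k)) (transpose_mat A) *\<^sub>v ?b = poly_mat (p ^ (r - k)) (transpose_mat A) *\<^sub>v b"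
        unfolding k'(2) power_Suc2 by (rule poly_mat_mult_vec[OF AT Suc.prems(1), symmetric])
      then show ?thesis using True k k' j by simp
    next
      case False
      then show ?thesis using Suc.prems(2) j by (auto split: option.splits)
    qed
    then have "case result (pseudo_loop A p t (Suc k) ?b ?s) j of None \<Rightarrow> Suc k + t \<le> r | Some x \<Rightarrow> x \<le> r"
      by (rule Suc.IH[OF mult_by_carrier[OF mul Suc.prems(1)]])
    then show ?thesis by (simp only: eq add_Suc add_Suc_right)
  qed
qed

lemma ops_pseudo_loop:
  assumes A: "A \<in> carrier_mat n n" and "b \<in> carrier_vec n" and deg: "1 \<le> degree p"
  shows "ops (pseudo_loop A p t k b s) \<le> 5 * n ^ 2 * (t * degree p)"
  using assms(2)
proof (induction t arbitrary: k b s)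
  case (Suc t)
  have mul: "mult_by (vec_mat_op A) (transpose_mat A) n" using A by (rule mult_by_vec_mat_op)
  let ?s = "\<lambda>j. if j < n \<and> s j = None \<and> b $ j = 0 then Some k else s j"
  have "ops (pseudo_loop A p (Suc t) k b s) \<le> ops (horner_op (vec_mat_op A) p b)
      + ops (pseudo_loop A p t (Suc k) (poly_mat p (transpose_mat A) *\<^sub>v b) ?s)"
    using A Suc.prems by (simp add: result_horner_op[OF mul])
  also have "\<dots> \<le> 5 * n ^ 2 * degree p + 5 * n ^ 2 * (t * degree p)"
    by (intro add_mono ops_horner_op[OF mul Suc.prems deg] Suc.IH mult_by_carrier[OF mul Suc.prems])
  finally show ?case by (simp add: algebra_simps)
qed simp


section \<open>Unit minimal annihilating polynomials\<close>

lemma poly_mat_power_Suc_vec: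
  assumes "A \<in> carrier_mat n n" "v \<in> carrier_vec n"
  shows "poly_mat (p ^ l) A *\<^sub>v (poly_mat p A *\<^sub>v v) = poly_mat (p ^ Suc l) A *\<^sub>v v"
  unfolding power_Suc2 by (rule poly_mat_mult_vec[OF assms, symmetric])

lemma update_vecs:
  assumes A: "A \<in> carrier_mat n n" and deg: "1 \<le> degree p"
    and "distinct ks" "\<And>k. k \<in> set ks \<Longrightarrow> vs k \<in> carrier_vec n"
  shows "result (update_vecs A p l ks vs) = (\<lambda>k. if k \<in> set ks then poly_mat (p ^ l) A *\<^sub>v vs k else vs k)"
    and "ops (update_vecs A p l ks vs) \<le> 5 * n ^ 2 * (length ks * (l * degree p))"
proof -
  have mul: "mult_by (mat_vec_op A) A n" using A by (rule mult_by_mat_vec_op)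
  have "result (update_vecs A p l ks vs) = (\<lambda>k. if k \<in> set ks then poly_mat (p ^ l) A *\<^sub>v vs k else vs k)
      \<and> ops (update_vecs A p l ks vs) \<le> 5 * n ^ 2 * (length ks * (l * degree p))"
    using assms(3,4)
  proof (induction ks arbitrary: vs)
    case Nil
    then show ?case by (simp add: update_vecs_def)
  next
    case (Cons k ks)
    have vk: "vs k \<in> carrier_vec n" using Cons.prems by simp
    let ?vs = "vs(k := poly_mat (p ^ l) A *\<^sub>v vs k)"
    have res: "result (apply_power (mat_vec_op A) p l (vs k)) = poly_mat (p ^ l) A *\<^sub>v vs k"
      by (rule result_apply_power[OF mul vk])
    have d: "distinct ks" and c: "\<And>i. i \<in> set ks \<Longrightarrow> ?vs i \<in> carrier_vec n"
      using Cons.prems by auto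
    have IH: "result (update_vecs A p l ks ?vs) = (\<lambda>k. if k \<in> set ks then poly_mat (p ^ l) A *\<^sub>v ?vs k else ?vs k)
        \<and> ops (update_vecs A p l ks ?vs) \<le> 5 * n ^ 2 * (length ks * (l * degree p))"
      by (rule Cons.IH[OF d]) (rule c)
    have "result (update_vecs A p l (k # ks) vs) = result (update_vecs A p l ks ?vs)"
      by (simp add: update_vecs_def res)
    also have "\<dots> = (\<lambda>i. if i \<in> set (k # ks) then poly_mat (p ^ l) A *\<^sub>v vs i else vs i)"
      unfolding conjunct1[OF IH] using Cons.prems(1) by (intro ext) auto
    finally have result: "result (update_vecs A p l (k # ks) vs) = \<dots>" .
    have "ops (update_vecs A p l (k # ks) vs)
        = ops (apply_power (mat_vec_op A) p l (vs k)) + ops (update_vecs A p l ks ?vs)"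
      by (simp add: update_vecs_def res)
    also have "\<dots> \<le> 5 * n ^ 2 * (l * degree p) + 5 * n ^ 2 * (length ks * (l * degree p))"
      by (intro add_mono ops_apply_power[OF mul vk deg] conjunct2[OF IH])
    finally show ?case using result by (simp add: algebra_simps)
  qed
  then show "result (update_vecs A p l ks vs) = (\<lambda>k. if k \<in> set ks then poly_mat (p ^ l) A *\<^sub>v vs k else vs k)"
    and "ops (update_vecs A p l ks vs) \<le> 5 * n ^ 2 * (length ks * (l * degree p))"
    by blast+
qed

text \<open>The entries of \<open>ls\<close> are only labels, returned when the vector vanishes. The
  list therefore stays arbitrary, so that the induction can drop its head, and applications are
  counted by position.\<close>

lemma ascend_loop_None:
  assumes A: "A \<in> carrier_mat n n" and deg: "1 \<le> degree p" and "v \<in> carrier_vec n"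
    and "\<And>l. 1 \<le> l \<Longrightarrow> l \<le> length ls \<Longrightarrow> poly_mat (p ^ l) A *\<^sub>v v \<noteq> 0\<^sub>v n"
  shows "result (ascend_loop A p ls v) = (None, poly_mat (p ^ length ls) A *\<^sub>v v)
    \<and> ops (ascend_loop A p ls v) \<le> 5 * n ^ 2 * (length ls * degree p)"
  using assms(3,4)
proof (induction ls arbitrary: v)
  case Nil
  then show ?case using poly_mat_1[OF A] by simp
next
  case (Cons l ls)
  have mul: "mult_by (mat_vec_op A) A n" using A by (rule mult_by_mat_vec_op)
  let ?w = "poly_mat p A *\<^sub>v v"
  have w: "?w \<in> carrier_vec n" by (rule mult_by_carrier[OF mul Cons.prems(1)])
  have nz: "?w \<noteq> 0\<^sub>v n" using Cons.prems(2)[of 1] by simp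
  have "result (ascend_loop A p ls ?w) = (None, poly_mat (p ^ length ls) A *\<^sub>v ?w)
    \<and> ops (ascend_loop A p ls ?w) \<le> 5 * n ^ 2 * (length ls * degree p)"
    using Cons.prems(2)[of "Suc _"]
    by (intro Cons.IH[OF w]) (simp add: poly_mat_power_Suc_vec[OF A Cons.prems(1)] del: power_Suc)
  moreover have "result (ascend_loop A p (l # ls) v) = result (ascend_loop A p ls ?w)"
    "ops (ascend_loop A p (l # ls) v) = ops (horner_op (mat_vec_op A) p v) + ops (ascend_loop A p ls ?w)"
    using nz A by (simp_all add: result_horner_op[OF mul Cons.prems(1)])
  ultimately show ?case
    using ops_horner_op[OF mul Cons.prems(1) deg]
    by (simp add: poly_mat_power_Suc_vec[OF A Cons.prems(1)] algebra_simps del: power_Suc)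
qed

text \<open>Here \<open>l\<close> is a position, and the test for zero follows the application;
  hence \<open>Suc l\<close> applications. For counters starting at 1 the label
  \<open>ls ! l\<close> is this number.\<close>

lemma ascend_loop_Some:
  assumes A: "A \<in> carrier_mat n n" and deg: "1 \<le> degree p" and "v \<in> carrier_vec n"
    and "l < length ls" "poly_mat (p ^ Suc l) A *\<^sub>v v = 0\<^sub>v n"
    and "\<And>k. 1 \<le> k \<Longrightarrow> k \<le> l \<Longrightarrow> poly_mat (p ^ k) A *\<^sub>v v \<noteq> 0\<^sub>v n"
  shows "result (ascend_loop A p ls v) = (Some (ls ! l), 0\<^sub>v n)
    \<and> ops (ascend_loop A p ls v) \<le> 5 * n ^ 2 * (Suc l * degree p)"
  using assms(3-)
proof (induction ls arbitrary: v l)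
  case Nil
  then show ?case by simp
next
  case (Cons a ls)
  have mul: "mult_by (mat_vec_op A) A n" using A by (rule mult_by_mat_vec_op)
  let ?w = "poly_mat p A *\<^sub>v v"
  have w: "?w \<in> carrier_vec n" by (rule mult_by_carrier[OF mul Cons.prems(1)])
  have horner: "ops (horner_op (mat_vec_op A) p v) \<le> 5 * n ^ 2 * degree p"
    by (rule ops_horner_op[OF mul Cons.prems(1) deg])
  show ?case
  proof (cases l)
    case 0
    then have "?w = 0\<^sub>v n" using Cons.prems(3) by simp
    then show ?thesis using 0 A horner by (simp add: result_horner_op[OF mul Cons.prems(1)])
  next
    case (Suc k)
    have nz: "?w \<noteq> 0\<^sub>v n" using Cons.prems(4)[of 1] Suc by simp
    have "result (ascend_loop A p ls ?w) = (Some (ls ! k), 0\<^sub>v n)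
      \<and> ops (ascend_loop A p ls ?w) \<le> 5 * n ^ 2 * (Suc k * degree p)"
      using Cons.prems(2,3) Cons.prems(4)[of "Suc _"] Suc
      by (intro Cons.IH[OF w]) (simp_all add: poly_mat_power_Suc_vec[OF A Cons.prems(1)] del: power_Suc)
    moreover have "result (ascend_loop A p (a # ls) v) = result (ascend_loop A p ls ?w)"
      "ops (ascend_loop A p (a # ls) v) = ops (horner_op (mat_vec_op A) p v) + ops (ascend_loop A p ls ?w)"
      using nz A by (simp_all add: result_horner_op[OF mul Cons.prems(1)])
    ultimately show ?thesis using horner Suc by (simp add: algebra_simps)
  qed
qed

text \<open>In contrast to the ascent, the test precedes the application: \<open>l\<close>
  applications are made, but the list must have a further entry, because the pass that finds zero
  performs the update. For counters starting at 0 the label \<open>ls ! l\<close> is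
  \<open>l\<close>.\<close>

lemma descend_loop:
  assumes A: "A \<in> carrier_mat n n" and deg: "1 \<le> degree p" and "v \<in> carrier_vec n"
    and "l < length ls" "poly_mat (p ^ l) A *\<^sub>v v = 0\<^sub>v n"
    and "\<And>k. k < l \<Longrightarrow> poly_mat (p ^ k) A *\<^sub>v v \<noteq> 0\<^sub>v n"
  shows "result (descend_loop A p k ls v vs r)
      = (result (update_vecs A p (ls ! l) (rev [0..<k - 1]) vs), r(k := r k + l))
    \<and> ops (descend_loop A p k ls v vs r)
      \<le> 5 * n ^ 2 * (l * degree p) + ops (update_vecs A p (ls ! l) (rev [0..<k - 1]) vs)"
  using assms(3-)
proof (induction ls arbitrary: v l r)
  case Nil
  then show ?case by simp
next
  case (Cons a ls)
  have mul: "mult_by (mat_vec_op A) A n" using A by (rule mult_by_mat_vec_op)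
  let ?w = "poly_mat p A *\<^sub>v v"
  have w: "?w \<in> carrier_vec n" by (rule mult_by_carrier[OF mul Cons.prems(1)])
  have horner: "ops (horner_op (mat_vec_op A) p v) \<le> 5 * n ^ 2 * degree p"
    by (rule ops_horner_op[OF mul Cons.prems(1) deg])
  have v: "poly_mat (p ^ 0) A *\<^sub>v v = v" using poly_mat_1[OF A] Cons.prems(1) by simp
  show ?case
  proof (cases l)
    case 0
    then have "v = 0\<^sub>v n" using Cons.prems(3) v by simp
    then show ?thesis using 0 A by simp
  next
    case (Suc i)
    have nz: "v \<noteq> 0\<^sub>v n" using Cons.prems(4)[of 0] Suc v by simp
    let ?r = "r(k := r k + 1)"
    have "result (descend_loop A p k ls ?w vs ?r)
        = (result (update_vecs A p (ls ! i) (rev [0..<k - 1]) vs), ?r(k := ?r k + i))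
      \<and> ops (descend_loop A p k ls ?w vs ?r)
        \<le> 5 * n ^ 2 * (i * degree p) + ops (update_vecs A p (ls ! i) (rev [0..<k - 1]) vs)"
      using Cons.prems(2,3) Cons.prems(4)[of "Suc _"] Suc
      by (intro Cons.IH[OF w]) (simp_all add: poly_mat_power_Suc_vec[OF A Cons.prems(1)] del: power_Suc)
    moreover have "result (descend_loop A p k (a # ls) v vs r) = result (descend_loop A p k ls ?w vs ?r)"
      "ops (descend_loop A p k (a # ls) v vs r)
        = ops (horner_op (mat_vec_op A) p v) + ops (descend_loop A p k ls ?w vs ?r)"
      using nz A by (simp_all add: result_horner_op[OF mul Cons.prems(1)])
    moreover have "?r(k := ?r k + i) = r(k := r k + l)" using Suc by (intro ext) simp
    ultimately show ?thesis using horner by (simp add: Suc fun_upd_def algebra_simps del: descend_loop.simps)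
  qed
qed

section \<open>Algorithm M followed on exponent vectors\<close>

locale factored_char_poly =
  fixes A :: "'a::field mat" and n q :: nat and f :: "nat \<Rightarrow> 'a poly" and m :: "nat \<Rightarrow> nat"
  assumes A: "A \<in> carrier_mat n n"
    and f: "\<And>i. i \<in> {1..q} \<Longrightarrow> monic (f i) \<and> irreducible (f i)"
    and inj_f: "inj_on f {1..q}"
    and char_poly: "char_poly A = (\<Prod>i=1..q. f i ^ m i)"
begin

lemma degree_factor: "i \<in> {1..q} \<Longrightarrow> 1 \<le> degree (f i)"
proof (rule ccontr)
  assume i: "i \<in> {1..q}" and "\<not> 1 \<le> degree (f i)"
  then have "degree (f i) = 0" by simp
  moreover have "f i \<noteq> 0" using f[OF i] by auto
  ultimately have "is_unit (f i)" by (simp add: is_unit_iff_degree)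
  then show False using f[OF i] irreducible_not_unit by blast
qed

lemma mult_by_A: "mult_by (mat_vec_op A) A n"
  using A by (rule mult_by_mat_vec_op)

end

locale unit_exponents = factored_char_poly +
  fixes j :: nat and r \<rho> :: "nat \<Rightarrow> nat"
  assumes unit_min_poly_eq: "unit_min_poly A j = (\<Prod>i=1..q. f i ^ r i)"
    and r_le: "i \<in> {1..q} \<Longrightarrow> r i \<le> m i"
    and \<rho>_le: "i \<in> {1..q} \<Longrightarrow> \<rho> i \<le> r i"
begin

definition act :: "(nat \<Rightarrow> nat) \<Rightarrow> 'a vec" where
  "act e = poly_mat (\<Prod>i=1..q. f i ^ e i) A *\<^sub>v unit_vec n j"

lemma act_carrier [simp]: "act e \<in> carrier_vec n"
  unfolding act_def by (rule mult_by_carrier[OF mult_by_A unit_vec_carrier])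

lemma act_cong: "(\<And>i. i \<in> {1..q} \<Longrightarrow> e i = e' i) \<Longrightarrow> act e = act e'"
  by (simp add: act_def)

lemma act_eq_0_iff: "act e = 0\<^sub>v n \<longleftrightarrow> (\<forall>i\<in>{1..q}. r i \<le> e i)"
proof -
  have "act e = 0\<^sub>v n \<longleftrightarrow> (\<Prod>i=1..q. f i ^ r i) dvd (\<Prod>i=1..q. f i ^ e i)"
    unfolding unit_min_poly_eq[symmetric] act_def by (rule unit_min_poly(2)[OF A, symmetric])
  also have "\<dots> \<longleftrightarrow> (\<forall>i\<in>{1..q}. r i \<le> e i)"
    by (rule prod_power_dvd_prod_power_iff[OF f inj_f finite_atLeastAtMost])
  finally show ?thesis .
qed

text \<open>Turns every run of \<open>f i\<close> in the loops into arithmetic on a single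
  exponent.\<close>

lemma power_act:
  assumes i: "i \<in> {1..q}"
  shows "poly_mat (f i ^ l) A *\<^sub>v act e = act (e(i := e i + l))"
proof -
  let ?R = "\<lambda>e. \<Prod>s\<in>{1..q} - {i}. f s ^ e s"
  have "f i ^ l * (\<Prod>s=1..q. f s ^ e s) = f i ^ l * (f i ^ e i * ?R e)"
    using i by (subst prod.remove[of _ i]) auto
  also have "\<dots> = f i ^ (e(i := e i + l)) i * ?R (e(i := e i + l))"
    by (simp add: power_add mult_ac)
  also have "\<dots> = (\<Prod>s=1..q. f s ^ (e(i := e i + l)) s)"
    using i by (subst prod.remove[of _ i]) auto
  finally show ?thesis
    unfolding act_def by (subst poly_mat_mult_vec[OF A unit_vec_carrier, symmetric]) (simp only:)
qed

text \<open>\<open>mixed t k\<close> is the exponent vector of \<open>v\<^sub>t\<close> at the moment when the final exponents of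
  \<open>f k, \<dots>, f q\<close> are known.\<close>

definition mixed :: "nat \<Rightarrow> nat \<Rightarrow> nat \<Rightarrow> nat" where
  "mixed t k s = (if s \<le> t then m s else if s < k then \<rho> s else r s)"

text \<open>The vector cannot vanish before \<open>f D\<close> has reached the exponent
  \<open>r D\<close>, and then it must: factors before \<open>D\<close> have exponent
  \<open>m\<close>, and those after \<open>D\<close> were complete from the start. The induction
  runs over the distance from the current index \<open>i\<close> to \<open>D\<close>.\<close>

lemma ascend:
  assumes D: "D \<in> {1..q}" "\<rho> D < r D" "\<And>s. D < s \<Longrightarrow> s \<le> q \<Longrightarrow> \<rho> s = r s"
    and i: "1 \<le> i" "i \<le> D" and v: "v = act (\<lambda>s. if s < i then m s else \<rho> s)"
    and vs: "\<And>k. k < i \<Longrightarrow> vs k = act (\<lambda>s. if s \<le> k then m s else \<rho> s)"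
  shows "\<exists>vs'. result (ascend A f m \<rho> [i..<Suc q] v vs r') = (D, vs', r'(D := r D))
    \<and> (\<forall>k<D. vs' k = act (mixed k D))
    \<and> ops (ascend A f m \<rho> [i..<Suc q] v vs r')
      \<le> 5 * n ^ 2 * ((\<Sum>s=i..D. (m s - \<rho> s) * degree (f s)) + D * ((r D - \<rho> D) * degree (f D)))"
  using i v vs
proof (induction "D - i" arbitrary: i v vs)
  case 0
  then have [simp]: "i = D" by simp
  \<comment> \<open>A position counted from 0, hence one less than the number of applications; since
    the counters in \<open>?ls\<close> start at 1, \<open>?ls ! ?l\<close> is that number
    again.\<close>
  let ?l = "r D - \<rho> D - 1" and ?ls = "[1..<Suc (m D - \<rho> D)]"
  have bounds: "r D \<le> m D" "Suc ?l = r D - \<rho> D" using r_le[OF D(1)] D(2) by auto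
  have v_act: "v \<in> carrier_vec n" "poly_mat (f D ^ k) A *\<^sub>v v = act ((\<lambda>s. if s < D then m s else \<rho> s)(D := \<rho> D + k))" for k
    using 0 power_act[OF D(1), of k "\<lambda>s. if s < D then m s else \<rho> s"] by auto
  have zero: "poly_mat (f D ^ Suc ?l) A *\<^sub>v v = 0\<^sub>v n"
    unfolding bounds(2) v_act act_eq_0_iff using D r_le by auto
  have nonzero: "poly_mat (f D ^ k) A *\<^sub>v v \<noteq> 0\<^sub>v n" if "1 \<le> k" "k \<le> ?l" for k
    unfolding v_act act_eq_0_iff using D(1,2) that by (auto intro!: bexI[of _ D])
  have loop: "result (ascend_loop A (f D) ?ls v) = (Some (?ls ! ?l), 0\<^sub>v n)
      \<and> ops (ascend_loop A (f D) ?ls v) \<le> 5 * n ^ 2 * (Suc ?l * degree (f D))"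
    by (rule ascend_loop_Some[OF A degree_factor[OF D(1)] v_act(1) _ zero nonzero])
      (use bounds D(2) in auto)
  have nth: "?ls ! ?l = r D - \<rho> D" using bounds D(2) by (subst nth_upt) auto
  note loop = loop[unfolded nth]
  let ?vs = "vs(D := 0\<^sub>v n)"
  have upd: "result (update_vecs A (f D) (r D - \<rho> D) (rev [0..<D]) ?vs)
      = (\<lambda>k. if k \<in> set (rev [0..<D]) then poly_mat (f D ^ (r D - \<rho> D)) A *\<^sub>v ?vs k else ?vs k)"
    "ops (update_vecs A (f D) (r D - \<rho> D) (rev [0..<D]) ?vs) \<le> 5 * n ^ 2 * (length (rev [0..<D]) * ((r D - \<rho> D) * degree (f D)))"
    by (rule update_vecs[OF A degree_factor[OF D(1)]]; use 0 in auto)+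
  have list: "[D..<Suc q] = D # [Suc D..<Suc q]" using D(1) by (simp add: upt_conv_Cons del: upt_Suc)
  let ?vs' = "result (update_vecs A (f D) (r D - \<rho> D) (rev [0..<D]) ?vs)"
  have res: "result (ascend A f m \<rho> [D..<Suc q] v vs r') = (D, ?vs', r'(D := r D))"
    unfolding list using loop D(2) A by (simp del: upt_Suc)
  have "ops (ascend A f m \<rho> [D..<Suc q] v vs r')
      = ops (ascend_loop A (f D) ?ls v) + ops (update_vecs A (f D) (r D - \<rho> D) (rev [0..<D]) ?vs)"
    unfolding list using loop A by (simp del: upt_Suc)
  also have "\<dots> \<le> 5 * n ^ 2 * ((m D - \<rho> D) * degree (f D)) + 5 * n ^ 2 * (D * ((r D - \<rho> D) * degree (f D)))"
  proof (intro add_mono)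
    \<comment> \<open>At \<open>D\<close> only \<open>r D - \<rho> D\<close> applications take
      place; enlarging this to \<open>m D - \<rho> D\<close> gives the summand the same form as
      those for smaller indices.\<close>
    have "Suc ?l * degree (f D) \<le> (m D - \<rho> D) * degree (f D)" using bounds by (intro mult_right_mono) auto
    then show "ops (ascend_loop A (f D) ?ls v) \<le> 5 * n ^ 2 * ((m D - \<rho> D) * degree (f D))"
      using conjunct2[OF loop] by (meson mult_le_mono2 le_trans)
    show "ops (update_vecs A (f D) (r D - \<rho> D) (rev [0..<D]) ?vs) \<le> 5 * n ^ 2 * (D * ((r D - \<rho> D) * degree (f D)))"
      using upd(2) by simp
  qed
  finally have ops: "ops (ascend A f m \<rho> [D..<Suc q] v vs r')
      \<le> 5 * n ^ 2 * ((\<Sum>s=D..D. (m s - \<rho> s) * degree (f s)) + D * ((r D - \<rho> D) * degree (f D)))"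
    by (simp add: algebra_simps)
  have "?vs' k = act (mixed k D)" if "k < D" for k
  proof -
    have "?vs' k = act ((\<lambda>s. if s \<le> k then m s else \<rho> s)(D := \<rho> D + (r D - \<rho> D)))"
      unfolding upd using that 0 power_act[OF D(1), of "r D - \<rho> D" "\<lambda>s. if s \<le> k then m s else \<rho> s"] by simp
    \<comment> \<open>The exponents are \<open>m\<close> up to \<open>k\<close>,
      \<open>\<rho>\<close> strictly between \<open>k\<close> and \<open>D\<close>, and
      \<open>r D\<close> at \<open>D\<close>; above \<open>D\<close>, \<open>\<rho>\<close> and
      \<open>r\<close> coincide.\<close>
    also have "\<dots> = act (mixed k D)" using that D by (intro act_cong) (auto simp: mixed_def)
    finally show ?thesis .
  qed
  then show ?case using res ops by auto
next
  case (Suc d)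
  then have i: "i < D" "1 \<le> i" "i \<in> {1..q}" using D(1) by auto
  let ?ls = "[1..<Suc (m i - \<rho> i)]"
  let ?e = "\<lambda>s. if s < i then m s else \<rho> s"
  have len: "length ?ls = m i - \<rho> i" by (simp del: upt_Suc)
  have le: "\<rho> i \<le> m i" using r_le \<rho>_le i by (meson le_trans)
  have v: "v \<in> carrier_vec n" "poly_mat (f i ^ k) A *\<^sub>v v = act (?e(i := \<rho> i + k))" for k
    using Suc.prems(3) power_act[OF i(3), of k ?e] by auto
  have nonzero: "poly_mat (f i ^ k) A *\<^sub>v v \<noteq> 0\<^sub>v n" for k
    unfolding v act_eq_0_iff using D(1,2) i by (auto intro!: bexI[of _ D])
  have loop: "result (ascend_loop A (f i) ?ls v) = (None, poly_mat (f i ^ length ?ls) A *\<^sub>v v)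
      \<and> ops (ascend_loop A (f i) ?ls v) \<le> 5 * n ^ 2 * (length ?ls * degree (f i))"
    by (rule ascend_loop_None[OF A degree_factor[OF i(3)] v(1) nonzero])
  let ?w = "act (\<lambda>s. if s < Suc i then m s else \<rho> s)"
  have w: "poly_mat (f i ^ length ?ls) A *\<^sub>v v = ?w"
    unfolding v len using le by (intro act_cong) auto
  have "\<exists>vs'. result (ascend A f m \<rho> [Suc i..<Suc q] ?w (vs(i := ?w)) r') = (D, vs', r'(D := r D))
    \<and> (\<forall>k<D. vs' k = act (mixed k D))
    \<and> ops (ascend A f m \<rho> [Suc i..<Suc q] ?w (vs(i := ?w)) r')
      \<le> 5 * n ^ 2 * ((\<Sum>s=Suc i..D. (m s - \<rho> s) * degree (f s)) + D * ((r D - \<rho> D) * degree (f D)))"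
    by (rule Suc.hyps(1)) (use Suc.hyps(2) Suc.prems i in \<open>auto simp: less_Suc_eq_le\<close>)
  moreover have list: "[i..<Suc q] = i # [Suc i..<Suc q]" using i(3) by (simp add: upt_conv_Cons del: upt_Suc)
  have "result (ascend A f m \<rho> [i..<Suc q] v vs r') = result (ascend A f m \<rho> [Suc i..<Suc q] ?w (vs(i := ?w)) r')"
    "ops (ascend A f m \<rho> [i..<Suc q] v vs r')
      = ops (ascend_loop A (f i) ?ls v) + ops (ascend A f m \<rho> [Suc i..<Suc q] ?w (vs(i := ?w)) r')"
    unfolding list using loop[unfolded w] by (simp_all del: upt_Suc length_upt)
  moreover have "(\<Sum>s=i..D. (m s - \<rho> s) * degree (f s))
      = (m i - \<rho> i) * degree (f i) + (\<Sum>s=Suc i..D. (m s - \<rho> s) * degree (f s))"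
    using i by (intro sum.atLeast_Suc_atMost) auto
  moreover have "ops (ascend_loop A (f i) ?ls v) \<le> 5 * n ^ 2 * ((m i - \<rho> i) * degree (f i))"
    using loop len by simp
  ultimately show ?case by (auto simp: distrib_left add.assoc intro!: add_mono)
qed

text \<open>In the vector tested for an index, the smaller exponents are \<open>m\<close> and the
  larger ones are exact, so the first zero occurs after exactly the missing number of applications.
  Only the vectors still to be tested need to satisfy the invariant, hence the condition
  \<open>Suc t < k\<close>.\<close>

lemma descend:
  assumes "k \<le> Suc q" "\<And>t. Suc t < k \<Longrightarrow> vs t = act (mixed t k)"
    and "\<And>s. s < k \<Longrightarrow> r' s = \<rho> s" "\<And>s. k \<le> s \<Longrightarrow> s \<le> q \<Longrightarrow> r' s = r s"
  shows "(\<forall>s\<in>{1..q}. result (descend A f m \<rho> (rev [1..<k]) vs r') s = r s)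
    \<and> ops (descend A f m \<rho> (rev [1..<k]) vs r')
      \<le> 5 * n ^ 2 * (\<Sum>s=1..<k. s * ((r s - \<rho> s) * degree (f s)))"
  using assms
proof (induction k arbitrary: vs r')
  case 0
  then show ?case by simp
next
  case (Suc k)
  show ?case
  proof (cases "k = 0")
    case True
    then show ?thesis using Suc.prems by simp
  next
    case False
    then have k: "k \<in> {1..q}" "Suc (k - 1) = k" using Suc.prems(1) by auto
    have list: "rev [1..<Suc k] = k # rev [1..<k]" using k by simp
    let ?l = "r k - \<rho> k" and ?ls = "[0..<Suc (m k - \<rho> k)]"
    \<comment> \<open>\<open>?l\<close> may be as large as \<open>m k - \<rho> k\<close>; it is
      still a position in \<open>?ls\<close> because the counters include that value.\<close>
    have l: "?l < length ?ls" "?ls ! ?l = ?l" "\<rho> k + ?l = r k" "r' k + ?l = r k"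
      using r_le[OF k(1)] \<rho>_le[OF k(1)] Suc.prems(3)[of k] by (auto simp: nth_append simp del: upt_Suc)
    have v: "vs (k - 1) = act (mixed (k - 1) (Suc k))" using Suc.prems(2)[of "k - 1"] k(2) by simp
    have v_act: "vs (k - 1) \<in> carrier_vec n"
      "poly_mat (f k ^ i) A *\<^sub>v vs (k - 1) = act ((mixed (k - 1) (Suc k))(k := \<rho> k + i))" for i
      using power_act[OF k(1), of i "mixed (k - 1) (Suc k)"] k(2) unfolding v by (auto simp: mixed_def)
    have zero: "poly_mat (f k ^ ?l) A *\<^sub>v vs (k - 1) = 0\<^sub>v n"
      unfolding v_act act_eq_0_iff l(3) using r_le by (auto simp: mixed_def)
    have nonzero: "poly_mat (f k ^ i) A *\<^sub>v vs (k - 1) \<noteq> 0\<^sub>v n" if "i < ?l" for i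
      unfolding v_act act_eq_0_iff using k(1) that by (auto intro!: bexI[of _ k])
    let ?U = "update_vecs A (f k) ?l (rev [0..<k - 1]) vs"
    have loop: "result (descend_loop A (f k) k ?ls (vs (k - 1)) vs r') = (result ?U, r'(k := r k))
        \<and> ops (descend_loop A (f k) k ?ls (vs (k - 1)) vs r') \<le> 5 * n ^ 2 * (?l * degree (f k)) + ops ?U"
      using descend_loop[OF A degree_factor[OF k(1)] v_act(1) l(1) zero nonzero, of k vs r']
      unfolding l(2,4) by blast
    have upd: "result ?U = (\<lambda>t. if t \<in> set (rev [0..<k - 1]) then poly_mat (f k ^ ?l) A *\<^sub>v vs t else vs t)"
      "ops ?U \<le> 5 * n ^ 2 * (length (rev [0..<k - 1]) * (?l * degree (f k)))"
      by (rule update_vecs[OF A degree_factor[OF k(1)]]; use Suc.prems(2) in auto)+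
    have "(\<forall>s\<in>{1..q}. result (descend A f m \<rho> (rev [1..<k]) (result ?U) (r'(k := r k))) s = r s)
      \<and> ops (descend A f m \<rho> (rev [1..<k]) (result ?U) (r'(k := r k)))
        \<le> 5 * n ^ 2 * (\<Sum>s=1..<k. s * ((r s - \<rho> s) * degree (f s)))"
    proof (rule Suc.IH)
      fix t assume t: "Suc t < k"
      then have "t \<in> set (rev [0..<k - 1])" "vs t = act (mixed t (Suc k))"
        using Suc.prems(2)[of t] by auto
      then have "result ?U t = poly_mat (f k ^ ?l) A *\<^sub>v act (mixed t (Suc k))"
        unfolding upd by simp
      also have "\<dots> = act ((mixed t (Suc k))(k := mixed t (Suc k) k + ?l))" by (rule power_act[OF k(1)])
      also have "\<dots> = act (mixed t k)" using l(3) t by (intro act_cong) (auto simp: mixed_def)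
      finally show "result ?U t = act (mixed t k)" .
    qed (use Suc.prems in auto)
    moreover have "result (descend A f m \<rho> (rev [1..<Suc k]) vs r')
        = result (descend A f m \<rho> (rev [1..<k]) (result ?U) (r'(k := r k)))"
      "ops (descend A f m \<rho> (rev [1..<Suc k]) vs r') = ops (descend_loop A (f k) k ?ls (vs (k - 1)) vs r')
        + ops (descend A f m \<rho> (rev [1..<k]) (result ?U) (r'(k := r k)))"
      unfolding list using loop by (simp_all del: upt_Suc)
    moreover have "ops (descend_loop A (f k) k ?ls (vs (k - 1)) vs r') \<le> 5 * n ^ 2 * (k * (?l * degree (f k)))"
    proof -
      have "5 * n ^ 2 * (?l * degree (f k)) + ops ?U
          \<le> 5 * n ^ 2 * (?l * degree (f k)) + 5 * n ^ 2 * ((k - 1) * (?l * degree (f k)))"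
        using upd(2) by simp
      \<comment> \<open>One share for finding \<open>r k\<close> and one for each of the
        \<open>k - 1\<close> vectors to be updated, so \<open>k\<close> shares in all.\<close>
      also have "\<dots> = 5 * n ^ 2 * (Suc (k - 1) * (?l * degree (f k)))" by (simp only: mult_Suc distrib_left)
      finally show ?thesis using conjunct2[OF loop] unfolding k(2) by (rule order_trans[rotated])
    qed
    moreover have "(\<Sum>s=1..<Suc k. s * ((r s - \<rho> s) * degree (f s)))
        = k * (?l * degree (f k)) + (\<Sum>s=1..<k. s * ((r s - \<rho> s) * degree (f s)))"
      using k by simp
    ultimately show ?thesis by (simp only: distrib_left) (blast intro: add_mono)
  qed
qed

lemma unit_min_exponents:
  defines "D \<equiv> Max (insert 0 {i \<in> {1..q}. \<rho> i < r i})"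
  shows "(\<forall>i\<in>{1..q}. result (unit_min_exponents A q f m \<rho> j) i = r i)
    \<and> ops (unit_min_exponents A q f m \<rho> j) \<le> 5 * n ^ 2 * ((\<Sum>i=1..q. \<rho> i * degree (f i))
      + (\<Sum>k=1..D. degree (f k) * ((m k - \<rho> k) + k * (r k - \<rho> k))))"
proof -
  have dim: "dim_row A = n" using A by simp
  let ?F = "apply_factors (mat_vec_op A) f \<rho> [1..<Suc q] (unit_vec n j)"
  have v: "result ?F = act \<rho>"
    unfolding act_def result_apply_factors[OF mult_by_A unit_vec_carrier] prod_list_upt
      atLeastLessThanSuc_atLeastAtMost ..
  have F: "ops ?F \<le> 5 * n ^ 2 * (\<Sum>i=1..q. \<rho> i * degree (f i))"
    by (rule ops_apply_factors[OF mult_by_A unit_vec_carrier, of "[1..<Suc q]" f \<rho>,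
          unfolded sum_list_upt atLeastLessThanSuc_atLeastAtMost]) (use degree_factor in auto)
  show ?thesis
  proof (cases "act \<rho> = 0\<^sub>v n")
    case True
    then have eq: "\<forall>i\<in>{1..q}. \<rho> i = r i" using act_eq_0_iff \<rho>_le by (metis le_antisym)
    have "result (unit_min_exponents A q f m \<rho> j) = \<rho>" "ops (unit_min_exponents A q f m \<rho> j) = ops ?F"
      unfolding unit_min_exponents_def dim using v True by (simp_all del: upt_Suc)
    then show ?thesis using eq F by (simp add: distrib_left trans_le_add1)
  next
    case False
    let ?S = "{i \<in> {1..q}. \<rho> i < r i}"
    obtain i where "i \<in> {1..q}" "\<not> r i \<le> \<rho> i" using False act_eq_0_iff by blast
    then have "?S \<noteq> {}" by (metis (no_types, lifting) empty_iff mem_Collect_eq not_le)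
    moreover have fin: "finite ?S" by simp
    \<comment> \<open>For a nonempty set the inserted default 0 is harmless, and \<open>D\<close> is
      the true maximum.\<close>
    ultimately have "D = max 0 (Max ?S)" unfolding D_def by (intro Max_insert)
    then have "D \<in> ?S" using Max_in[OF fin \<open>?S \<noteq> {}\<close>] by simp
    then have D: "D \<in> {1..q}" "\<rho> D < r D" by auto
    have above: "\<rho> s = r s" if "D < s" "s \<le> q" for s
    proof (rule ccontr)
      assume "\<rho> s \<noteq> r s"
      then have "s \<in> ?S" using that \<rho>_le[of s] by auto
      then have "s \<le> D" unfolding D_def by (intro Max_ge) auto
      then show False using that by simp
    qed
    obtain vs' where vs': "result (ascend A f m \<rho> [1..<Suc q] (act \<rho>) (\<lambda>_. act \<rho>) \<rho>) = (D, vs', \<rho>(D := r D))"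
        "\<And>k. k < D \<Longrightarrow> vs' k = act (mixed k D)"
      and ascend_ops: "ops (ascend A f m \<rho> [1..<Suc q] (act \<rho>) (\<lambda>_. act \<rho>) \<rho>)
      \<le> 5 * n ^ 2 * ((\<Sum>s=1..D. (m s - \<rho> s) * degree (f s)) + D * ((r D - \<rho> D) * degree (f D)))"
    proof -
      have "\<exists>vs'. result (ascend A f m \<rho> [1..<Suc q] (act \<rho>) (\<lambda>_. act \<rho>) \<rho>) = (D, vs', \<rho>(D := r D))
        \<and> (\<forall>k<D. vs' k = act (mixed k D))
        \<and> ops (ascend A f m \<rho> [1..<Suc q] (act \<rho>) (\<lambda>_. act \<rho>) \<rho>)
          \<le> 5 * n ^ 2 * ((\<Sum>s=1..D. (m s - \<rho> s) * degree (f s)) + D * ((r D - \<rho> D) * degree (f D)))"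
        by (rule ascend[OF D above]) (use D in \<open>auto intro!: act_cong\<close>)
      then show thesis using that by blast
    qed
    have desc: "(\<forall>s\<in>{1..q}. result (descend A f m \<rho> (rev [1..<D]) vs' (\<rho>(D := r D))) s = r s)
      \<and> ops (descend A f m \<rho> (rev [1..<D]) vs' (\<rho>(D := r D)))
        \<le> 5 * n ^ 2 * (\<Sum>s=1..<D. s * ((r s - \<rho> s) * degree (f s)))"
      by (rule descend) (use D vs'(2) above in auto)
    have "result (unit_min_exponents A q f m \<rho> j) = result (descend A f m \<rho> (rev [1..<D]) vs' (\<rho>(D := r D)))"
      "ops (unit_min_exponents A q f m \<rho> j) = ops ?F + ops (ascend A f m \<rho> [1..<Suc q] (act \<rho>) (\<lambda>_. act \<rho>) \<rho>)
        + ops (descend A f m \<rho> (rev [1..<D]) vs' (\<rho>(D := r D)))"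
      unfolding unit_min_exponents_def dim using v False vs'(1) by (simp_all del: upt_Suc)
    \<comment> \<open>The update term of the ascent at \<open>D\<close> is precisely the summand
      \<open>k = D\<close> that is missing from the descent, which covers only indices below
      \<open>D\<close>.\<close>
    moreover have "(\<Sum>k=1..D. degree (f k) * ((m k - \<rho> k) + k * (r k - \<rho> k)))
        = (\<Sum>s=1..D. (m s - \<rho> s) * degree (f s)) + D * ((r D - \<rho> D) * degree (f D))
          + (\<Sum>s=1..<D. s * ((r s - \<rho> s) * degree (f s)))"
    proof -
      have "(\<Sum>k=1..D. degree (f k) * ((m k - \<rho> k) + k * (r k - \<rho> k)))
          = (\<Sum>k=1..D. (m k - \<rho> k) * degree (f k)) + (\<Sum>k=1..D. k * ((r k - \<rho> k) * degree (f k)))"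
        unfolding sum.distrib[symmetric] by (intro sum.cong) (auto simp: algebra_simps)
      moreover have "{1..D} = insert D {1..<D}" using D(1) by auto
      ultimately show ?thesis by simp
    qed
    ultimately show ?thesis
      using desc F ascend_ops by (simp add: distrib_left)
  qed
qed

end


section \<open>Algorithm P, assembly of both algorithms, and the operation bound\<close>

lemma nth_map_upt_from_1:
  assumes "i \<in> {1..q}"
  shows "map h [1..<Suc q] ! (i - 1) = h i"
proof -
  have "[1..<Suc q] ! (i - 1) = i" using assms by (subst nth_upt) auto
  moreover have "i - 1 < length [1..<Suc q]" using assms by auto
  ultimately show ?thesis by (simp only: nth_map)
qed

context factored_char_poly
begin

text \<open>A monic divisor of the characteristic polynomial is a product of powers of the
  \<open>f i\<close>, and the divisibility criterion for these powers identifies its exponents with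
  the maximal ones in \<open>unit_exponent\<close>.\<close>

lemma unit_min_poly_eq_prod:
  "unit_min_poly A j = (\<Prod>i=1..q. f i ^ unit_exponent A f i j)"
  "i \<in> {1..q} \<Longrightarrow> unit_exponent A f i j \<le> m i"
proof -
  have dvd: "unit_min_poly A j dvd (\<Prod>i=1..q. f i ^ m i)"
    using unit_min_poly(3)[OF A, of j] unfolding char_poly .
  obtain r where r: "unit_min_poly A j = (\<Prod>i=1..q. f i ^ r i)" "\<And>i. i \<in> {1..q} \<Longrightarrow> r i \<le> m i"
    using monic_dvd_prod_powerE[OF f finite_atLeastAtMost unit_min_poly(1)[OF A] dvd] by blast
  have exponent: "unit_exponent A f i j = r i" if "i \<in> {1..q}" for i
    unfolding unit_exponent_def r(1)
    by (rule Greatest_equality)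
      (use irreducible_power_dvd_prod_power_iff[OF f inj_f finite_atLeastAtMost that] in auto)
  show "unit_min_poly A j = (\<Prod>i=1..q. f i ^ unit_exponent A f i j)"
    unfolding r(1) by (rule prod.cong) (simp_all add: exponent)
  show "i \<in> {1..q} \<Longrightarrow> unit_exponent A f i j \<le> m i" using exponent r(2) by simp
qed

text \<open>Comparison of degrees in the factorization; this turns a cost of \<open>5 n^2\<close>
  per degree into \<open>5 n^3\<close> for applying all factors once.\<close>

lemma sum_degree: "(\<Sum>i=1..q. m i * degree (f i)) = n"
  using degree_prod_power[of "{1..q}" f m] f char_poly degree_monic_char_poly[OF A] by simp

lemma alg_pseudo:
  assumes u: "u \<in> carrier_vec n" and q: "1 \<le> q"
  shows "i \<in> {1..q} \<Longrightarrow> j < n \<Longrightarrow> result (alg_pseudo A q f m u) i j \<le> unit_exponent A f i j"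
    and "q \<le> 2 ^ t \<Longrightarrow> ops (alg_pseudo A q f m u) \<le> 5 * n ^ 2 * (t * n) + 5 * n ^ 2 * n"
proof -
  let ?b = "\<lambda>p. poly_mat (\<Prod>i\<in>{1..q} - {p}. f i ^ m i) (transpose_mat A) *\<^sub>v u"
  have AT: "transpose_mat A \<in> carrier_mat n n" using A by simp
  have b: "?b p \<in> carrier_vec n" for p
    by (rule mult_by_carrier[OF mult_by_vec_mat_op[OF A] u])
  have split: "result (split_vecs A f m 1 q u) = map ?b [1..<Suc q]"
    by (rule split_vecs(1)[where f = f, OF A u q degree_factor]) simp
  have split_ops: "ops (split_vecs A f m 1 q u) \<le> 5 * n ^ 2 * (t * n)" if "q \<le> 2 ^ t" for t
    using split_vecs(2)[where f = f and m = m and t = t, OF A u q degree_factor] q that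
    unfolding sum_degree by (simp del: split_vecs.simps)
  have rows: "result (alg_pseudo A q f m u) i = result (pseudo_row A (f i) (m i) (?b i))" if "i \<in> {1..q}" for i
    unfolding alg_pseudo_def using that by (simp add: split nth_map_upt_from_1[OF that] del: split_vecs.simps upt_Suc One_nat_def)
  show "q \<le> 2 ^ t \<Longrightarrow> ops (alg_pseudo A q f m u) \<le> 5 * n ^ 2 * (t * n) + 5 * n ^ 2 * n"
  proof -
    assume t: "q \<le> 2 ^ t"
    have "ops (alg_pseudo A q f m u) = ops (split_vecs A f m 1 q u)
        + (\<Sum>i=1..q. ops (pseudo_row A (f i) (m i) (map ?b [1..<Suc q] ! (i - 1))))"
      unfolding alg_pseudo_def
      by (simp add: split sum_list_upt atLeastLessThanSuc_atLeastAtMost del: split_vecs.simps upt_Suc One_nat_def)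
    also have "(\<Sum>i=1..q. ops (pseudo_row A (f i) (m i) (map ?b [1..<Suc q] ! (i - 1))))
        = (\<Sum>i=1..q. ops (pseudo_row A (f i) (m i) (?b i)))"
      by (rule sum.cong) (simp_all only: nth_map_upt_from_1)
    also have "\<dots> \<le> (\<Sum>i=1..q. 5 * n ^ 2 * (m i * degree (f i)))"
    proof (rule sum_mono)
      fix i assume "i \<in> {1..q}"
      then show "ops (pseudo_row A (f i) (m i) (?b i)) \<le> 5 * n ^ 2 * (m i * degree (f i))"
        unfolding pseudo_row_def ops_bind ops_ret add_0_right by (rule ops_pseudo_loop[OF A b degree_factor])
    qed
    also have "\<dots> = 5 * n ^ 2 * n" by (simp only: sum_distrib_left[symmetric] sum_degree)
    finally show ?thesis using split_ops[OF t] by simp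
  qed
  assume i: "i \<in> {1..q}" and j: "j < n"
  let ?r = "unit_exponent A f i j"
  \<comment> \<open>The characteristic polynomial with the exponent of \<open>f i\<close> lowered to
    \<open>?r\<close>. It still annihilates \<open>e_j\<close>, since all other exponents are at
    their maximum.\<close>
  let ?P = "f i ^ ?r * (\<Prod>s\<in>{1..q} - {i}. f s ^ m s)"
  have "(\<Prod>s=1..q. f s ^ (m(i := ?r)) s)
      = f i ^ (m(i := ?r)) i * (\<Prod>s\<in>{1..q} - {i}. f s ^ (m(i := ?r)) s)"
    by (rule prod.remove) (use i in simp_all)
  also have "\<dots> = ?P" by simp
  finally have P: "(\<Prod>s=1..q. f s ^ (m(i := ?r)) s) = ?P" .
  have "(\<Prod>s=1..q. f s ^ unit_exponent A f s j) dvd (\<Prod>s=1..q. f s ^ (m(i := ?r)) s)"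
    by (rule iffD2[OF prod_power_dvd_prod_power_iff[of "{1..q}" f "\<lambda>s. unit_exponent A f s j"
            "m(i := ?r)", OF f inj_f finite_atLeastAtMost]])
      (use unit_min_poly_eq_prod(2) in auto)
  then have "unit_min_poly A j dvd ?P" unfolding unit_min_poly_eq_prod(1)[of j] P .
  then have zero: "poly_mat ?P A *\<^sub>v unit_vec n j = 0\<^sub>v n" using unit_min_poly(2)[OF A] by blast
  have "poly_mat (f i ^ ?r) (transpose_mat A) *\<^sub>v ?b i = transpose_mat (poly_mat ?P A) *\<^sub>v u"
    unfolding poly_mat_transpose[OF A, symmetric] by (rule poly_mat_mult_vec[OF AT u, symmetric])
  \<comment> \<open>Entry \<open>j\<close> is written as a scalar product with \<open>e_j\<close>,
    so that the transpose can be moved over to \<open>e_j\<close>, where \<open>zero\<close>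
    applies.\<close>
  then have "(poly_mat (f i ^ ?r) (transpose_mat A) *\<^sub>v ?b i) $ j
      = (transpose_mat (poly_mat ?P A) *\<^sub>v u) \<bullet> unit_vec n j"
    using j by simp
  also have "\<dots> = u \<bullet> (poly_mat ?P A *\<^sub>v unit_vec n j)"
    by (rule transpose_vec_mult_scalar[OF poly_mat_carrier[OF A] unit_vec_carrier u])
  also have "\<dots> = 0" using zero u by simp
  finally have "case result (pseudo_loop A (f i) (m i) 0 (?b i) (\<lambda>_. None)) j of
      None \<Rightarrow> 0 + m i \<le> ?r | Some x \<Rightarrow> x \<le> ?r"
    by (intro pseudo_loop_le[OF A b j]) simp
  then show "result (alg_pseudo A q f m u) i j \<le> ?r"
    unfolding rows[OF i] by (auto simp: pseudo_row_def split: option.splits)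
qed

lemma alg_min:
  assumes u: "u \<in> carrier_vec n" and q: "1 \<le> q"
  defines "\<rho> \<equiv> pseudo_exponent A q f m u" and "r \<equiv> unit_exponent A f"
    and "D \<equiv> last_deficient A q f m u"
  shows "i \<in> {1..q} \<Longrightarrow> j < n \<Longrightarrow> result (alg_min A q f m u) i j = r i j"
    and "q \<le> 2 ^ t \<Longrightarrow> ops (alg_min A q f m u) \<le> 5 * n ^ 2 * (t * n) + 5 * n ^ 2 * n
      + (\<Sum>j<n. 5 * n ^ 2 * (degree (unit_pseudo_poly A q f m u j)
          + (\<Sum>k=1..D j. degree (f k) * ((m k - \<rho> k j) + k * (r k j - \<rho> k j)))))"
proof -
  have \<rho>: "\<rho> = result (alg_pseudo A q f m u)" by (simp add: \<rho>_def pseudo_exponent_def)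
  have dim: "dim_row A = n" using A by simp
  have row: "(\<forall>i\<in>{1..q}. result (unit_min_exponents A q f m (\<lambda>i. \<rho> i j) j) i = r i j)
    \<and> ops (unit_min_exponents A q f m (\<lambda>i. \<rho> i j) j) \<le> 5 * n ^ 2 * (degree (unit_pseudo_poly A q f m u j)
      + (\<Sum>k=1..D j. degree (f k) * ((m k - \<rho> k j) + k * (r k j - \<rho> k j))))" if j: "j < n" for j
  proof -
    interpret unit_exponents A n q f m j "\<lambda>i. r i j" "\<lambda>i. \<rho> i j"
    proof unfold_locales
      show "unit_min_poly A j = (\<Prod>i=1..q. f i ^ r i j)"
        unfolding r_def by (rule unit_min_poly_eq_prod(1))
      fix i assume i: "i \<in> {1..q}"
      show "r i j \<le> m i" unfolding r_def by (rule unit_min_poly_eq_prod(2)[OF i])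
      show "\<rho> i j \<le> r i j" unfolding \<rho> r_def by (rule alg_pseudo(1)[OF u q i j])
    qed
    have "degree (unit_pseudo_poly A q f m u j) = (\<Sum>i=1..q. \<rho> i j * degree (f i))"
      unfolding unit_pseudo_poly_def \<rho>_def by (rule degree_prod_power) (use f in blast)
    moreover have "D j = Max (insert 0 {i \<in> {1..q}. \<rho> i j < r i j})"
      by (simp add: D_def last_deficient_def \<rho>_def r_def)
    ultimately show ?thesis using unit_min_exponents by simp
  qed
  show "i \<in> {1..q} \<Longrightarrow> j < n \<Longrightarrow> result (alg_min A q f m u) i j = r i j"
    unfolding alg_min_def using row[of j] by (simp add: dim \<rho>)
  have "ops (alg_min A q f m u) = ops (alg_pseudo A q f m u)
      + (\<Sum>j<n. ops (unit_min_exponents A q f m (\<lambda>i. \<rho> i j) j))"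
    unfolding alg_min_def by (simp add: dim \<rho> sum_list_upt atLeast0LessThan)
  then show "q \<le> 2 ^ t \<Longrightarrow> ops (alg_min A q f m u) \<le> 5 * n ^ 2 * (t * n) + 5 * n ^ 2 * n
      + (\<Sum>j<n. 5 * n ^ 2 * (degree (unit_pseudo_poly A q f m u j)
          + (\<Sum>k=1..D j. degree (f k) * ((m k - \<rho> k j) + k * (r k j - \<rho> k j)))))"
    using alg_pseudo(2)[OF u q, of t] row by (auto intro!: add_mono sum_mono)
qed

text \<open>Origin of 15: the tree has depth at most \<open>log 2 q + 1\<close>, which is at most
  twice the logarithmic factor of the bound, so it accounts for 10; the passes of Algorithm P
  account for 5. The sums belonging to Algorithm M need only the factor 5.\<close>

lemma ops_alg_min_le_ops_bound:
  assumes u: "u \<in> carrier_vec n" and q: "1 \<le> q"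
  shows "real (ops (alg_min A q f m u)) \<le> 15 * ops_bound A q f m u"
proof -
  let ?\<rho> = "pseudo_exponent A q f m u" and ?r = "unit_exponent A f" and ?D = "last_deficient A q f m u"
  let ?L = "max 1 (log 2 (real q))"
  define S1 where "S1 = (\<Sum>j<n. real (degree (unit_pseudo_poly A q f m u j)))"
  define S2 where "S2 = (\<Sum>j<n. \<Sum>k=1..?D j. real (degree (f k)) *
    ((real (m k) - real (?\<rho> k j)) + real k * (real (?r k j) - real (?\<rho> k j))))"
  define t where "t = nat \<lceil>log 2 (real q)\<rceil>"
  have log: "0 \<le> log 2 (real q)" using q by (simp add: zero_le_log_cancel_iff)
  have t: "log 2 (real q) \<le> real t" "real t \<le> log 2 (real q) + 1" using log unfolding t_def by linarith+
  have "real q = 2 powr (log 2 (real q))" using q by simp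
  also have "\<dots> \<le> 2 powr (real t)" using t(1) by simp
  finally have "real q \<le> real (2 ^ t)" by (simp add: powr_realpow)
  then have q_le: "q \<le> 2 ^ t" by (simp only: of_nat_le_iff)
  have \<rho>_le: "?\<rho> i j \<le> ?r i j" "?r i j \<le> m i" if "i \<in> {1..q}" "j < n" for i j
    using alg_pseudo(1)[OF u q that] unit_min_poly_eq_prod(2)[OF that(1)] by (auto simp: pseudo_exponent_def)
  have D_le: "?D j \<le> q" for j unfolding last_deficient_def by (intro Max.boundedI) auto
  \<comment> \<open>The operation count uses truncated subtraction, the bound subtraction of reals.
    They agree because \<open>\<rho>\<close> is at most \<open>r\<close> and \<open>m\<close> at
    every index up to \<open>?D j\<close>, which is at most \<open>q\<close>.\<close>
  have real_S2: "(\<Sum>j<n. real (\<Sum>k=1..?D j. degree (f k) * ((m k - ?\<rho> k j) + k * (?r k j - ?\<rho> k j)))) = S2"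
    unfolding S2_def
  proof (rule sum.cong[OF refl])
    fix j assume "j \<in> {..<n}"
    then have *: "?\<rho> k j \<le> ?r k j" "?\<rho> k j \<le> m k" if "k \<in> {1..?D j}" for k
      using \<rho>_le[of k j] D_le[of j] that by auto
    show "real (\<Sum>k=1..?D j. degree (f k) * ((m k - ?\<rho> k j) + k * (?r k j - ?\<rho> k j)))
      = (\<Sum>k=1..?D j. real (degree (f k)) *
          ((real (m k) - real (?\<rho> k j)) + real k * (real (?r k j) - real (?\<rho> k j))))"
      unfolding of_nat_sum
      by (rule sum.cong[OF refl]) (simp only: * of_nat_diff of_nat_mult of_nat_add)
  qed
  have "0 \<le> S1" unfolding S1_def by (simp add: sum_nonneg)
  have "0 \<le> S2" unfolding real_S2[symmetric] by (simp add: sum_nonneg)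
  have "real (ops (alg_min A q f m u)) \<le> real (5 * n ^ 2 * (t * n) + 5 * n ^ 2 * n
      + (\<Sum>j<n. 5 * n ^ 2 * (degree (unit_pseudo_poly A q f m u j)
          + (\<Sum>k=1..?D j. degree (f k) * ((m k - ?\<rho> k j) + k * (?r k j - ?\<rho> k j))))))"
    using alg_min(2)[OF u q q_le] by (simp only: of_nat_le_iff)
  also have "\<dots> = 5 * real n ^ 3 * real t + 5 * real n ^ 3 + 5 * real n ^ 2 * (S1 + S2)"
    unfolding real_S2[symmetric] S1_def sum.distrib[symmetric] sum_distrib_left
    by (simp add: power3_eq_cube power2_eq_square sum_distrib_left)
  also have "\<dots> \<le> 15 * (real n ^ 3 * ?L + real n ^ 2 * real (degree (min_poly A)) + real n ^ 2 * S1 + real n ^ 2 * S2)"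
  proof -
    have "real t \<le> 2 * ?L" using t(2) by simp
    then have "real n ^ 3 * real t \<le> real n ^ 3 * (2 * ?L)" by (intro mult_left_mono) auto
    moreover have "real n ^ 3 * 1 \<le> real n ^ 3 * ?L" by (intro mult_left_mono) auto
    moreover have "0 \<le> real n ^ 2 * real (degree (min_poly A))" "0 \<le> real n ^ 2 * S1" "0 \<le> real n ^ 2 * S2"
      using \<open>0 \<le> S1\<close> \<open>0 \<le> S2\<close> by auto
    ultimately show ?thesis by (simp only: distrib_left)
  qed
  also have "\<dots> = 15 * ops_bound A q f m u"
    using A by (simp add: ops_bound_def Let_def S1_def S2_def)
  finally show ?thesis .
qed

end

text \<open>The random choice of \<open>u\<close> is modelled by quantifying over all nonzero
  \<open>u\<close>. The constant \<open>C\<close> precedes all other variables, which expresses the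
  uniformity of the O-bound.\<close>

theorem theorem9:
  shows "\<exists>C::real. \<forall>n (A :: 'a::field_char_0 mat) q f m u.
    A \<in> carrier_mat n n \<longrightarrow>
    (\<forall>i\<in>{1..q}. monic (f i) \<and> irreducible (f i) \<and> 1 \<le> m i) \<longrightarrow>
    inj_on f {1..q} \<longrightarrow>
    char_poly A = (\<Prod>i=1..q. f i ^ m i) \<longrightarrow>
    u \<in> carrier_vec n \<longrightarrow> u \<noteq> 0\<^sub>v n \<longrightarrow>
      (\<forall>j<n. unit_min_poly A j = (\<Prod>i=1..q. f i ^ result (alg_min A q f m u) i j)) \<and>
      real (ops (alg_min A q f m u)) \<le> C * ops_bound A q f m u"
proof (intro exI[of _ 15] allI impI)
  fix n q :: nat and A :: "'a mat" and f :: "nat \<Rightarrow> 'a poly" and m :: "nat \<Rightarrow> nat" and u :: "'a vec"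
  assume *: "A \<in> carrier_mat n n" "\<forall>i\<in>{1..q}. monic (f i) \<and> irreducible (f i) \<and> 1 \<le> m i"
    "inj_on f {1..q}" "char_poly A = (\<Prod>i=1..q. f i ^ m i)" and u: "u \<in> carrier_vec n" "u \<noteq> 0\<^sub>v n"
  then interpret factored_char_poly A n q f m by unfold_locales auto
  \<comment> \<open>Without factors the characteristic polynomial would be 1, forcing
    \<open>n = 0\<close>, and then \<open>u\<close> could not be nonzero.\<close>
  have q: "1 \<le> q"
  proof (rule ccontr)
    assume "\<not> 1 \<le> q"
    then have "n = 0" using sum_degree by simp
    then show False using u by auto
  qed
  show "(\<forall>j<n. unit_min_poly A j = (\<Prod>i=1..q. f i ^ result (alg_min A q f m u) i j)) \<and>
      real (ops (alg_min A q f m u)) \<le> 15 * ops_bound A q f m u"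
    using ops_alg_min_le_ops_bound[OF u(1) q] alg_min(1)[OF u(1) q] unit_min_poly_eq_prod(1) by simp
qed

end
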